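(* Let $I$ be a compact real interval and let $f : I \to I$ be a continuous turbulent map. Then there exist a fixed point $z$ of $f$, a point $b \in I$ with $b \ne z$ and $f(b) = z$, and an uncountable invariant $|b-z|$-scrambled set $S \subset [z:b]$ of $f$ contained in the recurrent set of $f$, such that the set $\bigcap_{x \in S} \omega(x, f)$ contains $\{z, b\} \cup S$ and, for every positive integer $n$, contains a periodic point of $f$ of least period $n$ or $2n$.
   Context: $f^n$ denotes the $n$-th iterate of $f$. A point $c$ is a periodic point of $f$ with least period $m$ if $f^m(c)=c$ and $f^i(c)\ne c$ for $0<i<m$. A continuous map $f: I\to I$ is turbulent if there exist two closed (nondegenerate) subintervals $J_0, J_1$ of $I$ with at most one common point such that $f(J_0)\cap f(J_1) \supset J_0\cup J_1$. For $\delta>0$, an uncountable set $S\subset I$ is a $\delta$-scrambled set of $f$ if (i) for any $x\neq y$ in $S$, $\limsup_{n\to\infty}|f^n(x)-f^n(y)|\ge\delta$ and $\liminf_{n\to\infty}|f^n(x)-f^n(y)|=0$; and (ii) for any $x\in S$ and any periodic point $p$ of $f$, $\limsup_{n\to\infty}|f^n(x)-f^n(p)|\ge\delta/2$. A set $S$ is invariant (under $f$) if $f(S)\subset S$. $\omega(x,f)$ is the $\omega$-limit set of $x$ under $f$, i.e. the set of limits of subsequences of $(f^n(x))_{n\ge 0}$. A point $x$ is recurrent if $x\in\omega(x,f)$, and the recurrent set of $f$ is the set of all recurrent points of $f$. $[z:b]$ denotes the closed interval with endpoints $z$ and $b$ (in either order). *)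

theory Defs
  imports "HOL-Analysis.Analysis"
begin

text \<open>A self-map of \<open>I\<close> is represented by a function on all reals, with hypotheses only on \<open>I\<close>.
  The notions below therefore carry \<open>I\<close> as a parameter wherever the values of \<open>f\<close> outside \<open>I\<close>
  could otherwise matter.\<close>

definition has_least_period :: "real set \<Rightarrow> (real \<Rightarrow> real) \<Rightarrow> nat \<Rightarrow> real \<Rightarrow> bool" where
  "has_least_period I f m c \<longleftrightarrow>
     c \<in> I \<and> 0 < m \<and> (f ^^ m) c = c \<and> (\<forall>i. 0 < i \<and> i < m \<longrightarrow> (f ^^ i) c \<noteq> c)"

definition periodic_point :: "real set \<Rightarrow> (real \<Rightarrow> real) \<Rightarrow> real \<Rightarrow> bool" where
  "periodic_point I f c \<longleftrightarrow> (\<exists>m. has_least_period I f m c)"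

definition turbulent :: "real set \<Rightarrow> (real \<Rightarrow> real) \<Rightarrow> bool" where
  "turbulent I f \<longleftrightarrow>
     (\<exists>a0 b0 a1 b1.
        a0 < b0 \<and> a1 < b1 \<and> {a0..b0} \<subseteq> I \<and> {a1..b1} \<subseteq> I \<and>
        (\<exists>p. {a0..b0} \<inter> {a1..b1} \<subseteq> {p}) \<and>
        {a0..b0} \<union> {a1..b1} \<subseteq> f ` {a0..b0} \<inter> f ` {a1..b1})"

text \<open>Upper and lower limits are taken in the extended reals, where they always exist.\<close>

definition scrambled_set :: "real set \<Rightarrow> (real \<Rightarrow> real) \<Rightarrow> real \<Rightarrow> real set \<Rightarrow> bool" where
  "scrambled_set I f \<delta> S \<longleftrightarrow>
     0 < \<delta> \<and> S \<subseteq> I \<and> uncountable S \<and>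
     (\<forall>x\<in>S. \<forall>y\<in>S. x \<noteq> y \<longrightarrow>
        limsup (\<lambda>n. ereal \<bar>(f ^^ n) x - (f ^^ n) y\<bar>) \<ge> ereal \<delta> \<and>
        liminf (\<lambda>n. ereal \<bar>(f ^^ n) x - (f ^^ n) y\<bar>) = 0) \<and>
     (\<forall>x\<in>S. \<forall>p. periodic_point I f p \<longrightarrow>
        limsup (\<lambda>n. ereal \<bar>(f ^^ n) x - (f ^^ n) p\<bar>) \<ge> ereal (\<delta> / 2))"

definition invariant_set :: "(real \<Rightarrow> real) \<Rightarrow> real set \<Rightarrow> bool" where
  "invariant_set f S \<longleftrightarrow> f ` S \<subseteq> S"

definition omega_limit :: "(real \<Rightarrow> real) \<Rightarrow> real \<Rightarrow> real set" where
  "omega_limit f x =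
     {y. \<exists>r :: nat \<Rightarrow> nat. strict_mono r \<and> (\<lambda>k. (f ^^ r k) x) \<longlonglongrightarrow> y}"

definition recurrent_set :: "real set \<Rightarrow> (real \<Rightarrow> real) \<Rightarrow> real set" where
  "recurrent_set I f = {x \<in> I. x \<in> omega_limit f x}"

end

(*
  Refining the turbulence condition gives points z, c, b (with c strictly between z and b) such that
  f z = z, f b = z, f c = b, f has no fixed point in (z, c] and does not take the value z on [c, b).
  Take z < b. The extremal inverse branches of f over J0 = [z, c] and J1 = [c, b] are strictly
  monotone, though possibly discontinuous, so the cylinders they generate have disjoint interiors and
  all but countably many 0-1 sequences shrink to a single point. The choice of z, c, b makes 000...
  shrink to z and 1000... shrink to b. S consists of the points coded by the shifts of an uncountable
  family of sequences containing every finite word, any two shifts of which show a 1 against a 0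
  followed by long common blocks of 0 infinitely often; the first property gives the claims about
  omega-limit sets, the second one scrambling. The code of period n with block 1 0...0 yields the
  periodic points: its composed branch E is decreasing, so the even iterates of E at z increase to
  a point of period 2n, and the itinerary forces the least period to be a multiple of n.
*)

theory Submission
  imports Defs "HOL-Library.Discrete_Functions"
begin

subsection \<open>Symbolic sequences\<close>

text \<open>Window \<open>k\<close> of a sequence is \<open>{k\<^sup>2..<(k+1)\<^sup>2}\<close>: it starts with a block of length at most \<open>k\<close>
  (a word common to all sequences, or one digit of \<open>\<alpha>\<close>), followed by more than \<open>k\<close> zeros.\<close>

definition block :: "(nat \<Rightarrow> bool) \<Rightarrow> nat \<Rightarrow> bool list" where
  "block \<alpha> k = (case from_nat (fst (prod_decode k)) :: bool list + nat of
     Inl w \<Rightarrow> take k w | Inr a \<Rightarrow> [\<alpha> a])"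

definition code :: "(nat \<Rightarrow> bool) \<Rightarrow> nat \<Rightarrow> bool" where
  "code \<alpha> i = (let k = floor_sqrt i; j = i - k\<^sup>2 in j < length (block \<alpha> k) \<and> block \<alpha> k ! j)"

lemma code_window:
  assumes "j \<le> 2 * k"
  shows "code \<alpha> (k\<^sup>2 + j) \<longleftrightarrow> j < length (block \<alpha> k) \<and> block \<alpha> k ! j"
proof -
  have "floor_sqrt (k\<^sup>2 + j) = k"
    by (rule floor_sqrt_unique) (use assms in \<open>auto simp: power2_eq_square\<close>)
  then show ?thesis
    by (simp add: code_def Let_def)
qed

text \<open>\<open>block\<close> looks only at the first component of the pair encoded by
  \<open>k\<close>. The second is free, so each key owns infinitely many windows; giving it the
  value \<open>N\<close> makes \<open>k\<close> at least \<open>N\<close>.\<close>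

lemma block_key_recurs:
  obtains k where "k \<ge> N" "from_nat (fst (prod_decode k)) = (x :: bool list + nat)"
proof
  show "prod_encode (to_nat x, N) \<ge> N" by (rule le_prod_encode_2)
qed simp

lemma code_word_occurs:
  obtains m where "m \<ge> N" "\<And>i. i < length w \<Longrightarrow> code \<alpha> (m + i) = w ! i"
proof -
  \<comment> \<open>The bound by \<open>length w\<close> ensures that the truncation
    \<open>take k w\<close> keeps all of \<open>w\<close>.\<close>
  obtain k where k: "k \<ge> max N (length w)" "from_nat (fst (prod_decode k)) = (Inl w :: bool list + nat)"
    by (rule block_key_recurs)
  have "k\<^sup>2 \<ge> N"
    using k(1) power2_nat_le_imp_le[of k "k\<^sup>2"] self_le_power[of k 2] by (cases "k = 0") auto
  moreover have "code \<alpha> (k\<^sup>2 + i) = w ! i" if "i < length w" for i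
    using that k by (subst code_window) (auto simp: block_def)
  ultimately show ?thesis using that by blast
qed

text \<open>The key \<open>Inl [True]\<close> does not involve \<open>\<alpha>\<close>, so one
  position \<open>m\<close> serves all codes at once. The comparison of two different shifts relies
  on this uniformity.\<close>

lemma code_isolated_one:
  obtains m where "m \<ge> N" "\<And>\<alpha>. code \<alpha> m" "\<And>\<alpha> i. 0 < i \<Longrightarrow> i \<le> L \<Longrightarrow> \<not> code \<alpha> (m + i)"
proof -
  obtain k where k: "k \<ge> max (Suc L) N" "from_nat (fst (prod_decode k)) = (Inl [True] :: bool list + nat)"
    by (rule block_key_recurs)
  have b: "block \<alpha> k = [True]" for \<alpha>
    using k by (simp add: block_def)
  have "k\<^sup>2 \<ge> N"
    using k(1) self_le_power[of k 2] by auto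
  moreover have "code \<alpha> (k\<^sup>2)" for \<alpha>
    using code_window[of 0 k \<alpha>] b by simp
  moreover have "\<not> code \<alpha> (k\<^sup>2 + i)" if "0 < i" "i \<le> L" for \<alpha> i
    using that k(1) by (subst code_window) (auto simp: b)
  ultimately show ?thesis using that by blast
qed

text \<open>The key \<open>Inr a\<close> puts the digit on which \<open>\<alpha>\<close> and
  \<open>\<beta>\<close> disagree at the start of infinitely many windows, and the rest of such a
  window is zero in both codes.\<close>

lemma code_separating_position:
  assumes "\<alpha> a \<noteq> \<beta> a"
  obtains m where "m \<ge> N" "code \<alpha> m \<noteq> code \<beta> m"
    "\<And>i. 0 < i \<Longrightarrow> i \<le> L \<Longrightarrow> \<not> code \<alpha> (m + i) \<and> \<not> code \<beta> (m + i)"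
proof -
  obtain k where k: "k \<ge> max (Suc L) N" "from_nat (fst (prod_decode k)) = (Inr a :: bool list + nat)"
    by (rule block_key_recurs)
  have b: "block \<gamma> k = [\<gamma> a]" for \<gamma>
    using k by (simp add: block_def)
  have "k\<^sup>2 \<ge> N"
    using k(1) self_le_power[of k 2] by auto
  moreover have "code \<alpha> (k\<^sup>2) \<noteq> code \<beta> (k\<^sup>2)"
    using code_window[of 0 k] b assms by simp
  moreover have "\<not> code \<alpha> (k\<^sup>2 + i) \<and> \<not> code \<beta> (k\<^sup>2 + i)" if "0 < i" "i \<le> L" for i
    using that k(1) by (simp add: code_window b)
  ultimately show ?thesis using that by blast
qed

abbreviation (input) shift :: "nat \<Rightarrow> (nat \<Rightarrow> bool) \<Rightarrow> nat \<Rightarrow> bool" where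
  "shift k s \<equiv> \<lambda>i. s (k + i)"

text \<open>For different shifts, take an isolated 1 common to all codes: when the smaller shift
  reads it, the larger one is already past it, among the zeros. The run of zeros is chosen longer by
  the difference of the shifts, so that both go on with \<open>L\<close> zeros. For equal shifts a
  digit that tells \<open>\<alpha>\<close> from \<open>\<beta>\<close> does the same.\<close>

lemma shifted_codes_differ:
  assumes "i \<noteq> j \<or> \<alpha> \<noteq> \<beta>"
  obtains n where "n \<ge> N" "shift i (code \<alpha>) n \<noteq> shift j (code \<beta>) n"
    "\<And>r. 0 < r \<Longrightarrow> r \<le> L \<Longrightarrow> \<not> shift i (code \<alpha>) (n + r) \<and> \<not> shift j (code \<beta>) (n + r)"
proof -
  have first_marker: "\<exists>n\<ge>N. shift i (code \<alpha>) n \<noteq> shift j (code \<beta>) n \<and>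
      (\<forall>r. 0 < r \<and> r \<le> L \<longrightarrow> \<not> shift i (code \<alpha>) (n + r) \<and> \<not> shift j (code \<beta>) (n + r))"
    if "i < j" for i j \<alpha> \<beta>
  proof -
    obtain m where m: "m \<ge> N + i" "\<And>\<alpha>. code \<alpha> m"
      "\<And>\<alpha> r. 0 < r \<Longrightarrow> r \<le> L + (j - i) \<Longrightarrow> \<not> code \<alpha> (m + r)"
      using code_isolated_one[of "N + i" "L + (j - i)"] by metis
    have "\<not> code \<gamma> (j + (m - i + r))" if "r \<le> L" for \<gamma> r
      using m(1) m(3)[of "j - i + r" \<gamma>] that \<open>i < j\<close> by (simp add: algebra_simps)
    moreover have "\<not> code \<gamma> (i + (m - i + r))" if "0 < r" "r \<le> L" for \<gamma> r
      using m(1) m(3)[of r \<gamma>] that by (simp add: algebra_simps)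
    moreover have "code \<gamma> (i + (m - i))" for \<gamma>
      using m(1,2) by simp
    ultimately show ?thesis
      using m(1) by (intro exI[of _ "m - i"]) (metis add_0_right diff_add_inverse2 diff_le_mono zero_le)
  qed
  have "\<exists>n\<ge>N. shift i (code \<alpha>) n \<noteq> shift j (code \<beta>) n \<and>
      (\<forall>r. 0 < r \<and> r \<le> L \<longrightarrow> \<not> shift i (code \<alpha>) (n + r) \<and> \<not> shift j (code \<beta>) (n + r))"
  proof (cases i j rule: linorder_cases)
    case equal
    then obtain a where "\<alpha> a \<noteq> \<beta> a"
      using assms by auto
    then obtain m where m: "m \<ge> N + i" "code \<alpha> m \<noteq> code \<beta> m"
      "\<And>r. 0 < r \<Longrightarrow> r \<le> L \<Longrightarrow> \<not> code \<alpha> (m + r) \<and> \<not> code \<beta> (m + r)"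
      by (rule code_separating_position[of \<alpha> a \<beta> "N + i" L]) blast
    have "i + (m - i + r) = m + r" for r
      using m(1) by simp
    then show ?thesis
      using m equal by (intro exI[of _ "m - i"]) (simp add: le_diff_conv2)
  next
    case less
    then show ?thesis by (rule first_marker)
  next
    case greater
    then show ?thesis using first_marker[of j i \<beta> \<alpha>] by metis
  qed
  then show ?thesis using that by blast
qed

section \<open>Uncountability and criteria for limits\<close>

lemma uncountable_UNIV_nat_bool: "uncountable (UNIV :: (nat \<Rightarrow> bool) set)"
proof
  assume "countable (UNIV :: (nat \<Rightarrow> bool) set)"
  then have "range (from_nat_into (UNIV :: (nat \<Rightarrow> bool) set)) = UNIV"
    by (intro range_from_nat_into) auto
  then have "(\<lambda>k. \<not> from_nat_into (UNIV :: (nat \<Rightarrow> bool) set) k k) \<in> range (from_nat_into UNIV)"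
    by simp
  then obtain n where "(\<lambda>k. \<not> from_nat_into (UNIV :: (nat \<Rightarrow> bool) set) k k) = from_nat_into UNIV n"
    by (rule rangeE)
  from fun_cong[OF this, of n] show False by simp
qed

lemma omega_limitI:
  assumes "\<And>e N. e > 0 \<Longrightarrow> \<exists>m\<ge>N. \<bar>(f ^^ m) x - y\<bar> < e"
  shows "y \<in> omega_limit f x"
proof -
  have "\<exists>r. strict_mono r \<and> (\<forall>k. \<bar>(f ^^ r k) x - y\<bar> < inverse (Suc k))"
  proof -
    have "\<exists>r. \<forall>k. \<bar>(f ^^ r k) x - y\<bar> < inverse (Suc k) \<and> r k < r (Suc k)"
    proof (rule dependent_nat_choice)
      show "\<exists>m. \<bar>(f ^^ m) x - y\<bar> < inverse (real (Suc 0))"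
        using assms[of "inverse (Suc 0)" 0] by auto
      show "\<exists>m'. \<bar>(f ^^ m') x - y\<bar> < inverse (real (Suc (Suc n))) \<and> m < m'" for m n
        using assms[of "inverse (Suc (Suc n))" "Suc m"] by (auto simp: Suc_le_eq)
    qed
    then show ?thesis by (auto simp: strict_mono_Suc_iff)
  qed
  then obtain r where r: "strict_mono r" "\<And>k. \<bar>(f ^^ r k) x - y\<bar> < inverse (Suc k)"
    by blast
  have "(\<lambda>k. (f ^^ r k) x - y) \<longlonglongrightarrow> 0"
    by (rule Lim_null_comparison[OF _ LIMSEQ_inverse_real_of_nat])
       (use r(2) in \<open>auto intro!: always_eventually less_imp_le\<close>)
  then show ?thesis
    unfolding omega_limit_def using r(1) by (auto simp: LIM_zero_iff)
qed

lemma limsup_geI: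
  fixes g :: "nat \<Rightarrow> real"
  assumes "\<And>e N. e > 0 \<Longrightarrow> \<exists>n\<ge>N. g n > d - e"
  shows "limsup (\<lambda>n. ereal (g n)) \<ge> ereal d"
proof (rule ereal_le_epsilon2)
  fix e :: real assume "0 < e"
  have "ereal (d - e) \<le> limsup (\<lambda>n. ereal (g n))"
    unfolding limsup_INF_SUP
  proof (rule INF_greatest)
    fix N :: nat
    obtain n where "n \<ge> N" "g n > d - e"
      using assms[OF \<open>0 < e\<close>] by blast
    then show "ereal (d - e) \<le> (SUP n\<in>{N..}. ereal (g n))"
      by (intro SUP_upper2[of n]) auto
  qed
  then show "ereal d \<le> limsup (\<lambda>n. ereal (g n)) + ereal e"
    by (cases "limsup (\<lambda>n. ereal (g n))") auto
qed

lemma liminf_eq_0I: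
  fixes g :: "nat \<Rightarrow> real"
  assumes "\<And>n. g n \<ge> 0" "\<And>e N. e > 0 \<Longrightarrow> \<exists>n\<ge>N. g n < e"
  shows "liminf (\<lambda>n. ereal (g n)) = 0"
proof (rule antisym)
  show "liminf (\<lambda>n. ereal (g n)) \<ge> 0"
    using assms(1) by (intro Liminf_bounded always_eventually) simp
  show "liminf (\<lambda>n. ereal (g n)) \<le> 0"
  proof (rule ereal_le_epsilon2)
    fix e :: real assume "0 < e"
    have "liminf (\<lambda>n. ereal (g n)) \<le> ereal e"
      unfolding liminf_SUP_INF
    proof (rule SUP_least)
      fix N :: nat
      obtain n where "n \<ge> N" "g n < e"
        using assms(2)[OF \<open>0 < e\<close>] by blast
      then show "(INF n\<in>{N..}. ereal (g n)) \<le> ereal e"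
        by (intro INF_lower2[of n]) auto
    qed
    then show "liminf (\<lambda>n. ereal (g n)) \<le> 0 + ereal e" by simp
  qed
qed

lemma funpow_fixed: "f z = z \<Longrightarrow> (f ^^ n) z = z"
  by (induction n) auto

lemma continuous_on_funpow:
  assumes "continuous_on A f" "f ` A \<subseteq> A"
  shows "continuous_on A (f ^^ n) \<and> (f ^^ n) ` A \<subseteq> A"
proof (induction n)
  case (Suc n)
  then show ?case
    using assms by (auto intro!: continuous_on_compose simp: comp_def image_subset_iff
      intro: continuous_on_subset continuous_on_compose2)
qed (auto simp: continuous_on_id)

subsection \<open>Coding by monotone inverse branches\<close>

text \<open>\<open>f\<close> may map points of \<open>{z..b}\<close> out of this segment; only the
  inverse branches are sure to stay inside. The ambient \<open>I\<close>, mapped into itself, is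
  what makes the iterates of \<open>f\<close> continuous on a fixed domain.\<close>

locale horseshoe =
  fixes I :: "real set" and f :: "real \<Rightarrow> real" and z c b :: real
  assumes segment_subset: "{z..b} \<subseteq> I"
    and continuous: "continuous_on I f" and self_map: "f ` I \<subseteq> I"
    and z_less_c: "z < c" and c_less_b: "c < b"
    and f_z: "f z = z" and f_b: "f b = z" and f_c: "f c = b"
    and no_fixed: "\<And>x. z < x \<Longrightarrow> x \<le> c \<Longrightarrow> f x \<noteq> x"
    and no_preimage: "\<And>x. c \<le> x \<Longrightarrow> x < b \<Longrightarrow> f x \<noteq> z"
begin

lemma cont: "{x..y} \<subseteq> {z..b} \<Longrightarrow> continuous_on {x..y} f"
  using continuous segment_subset by (meson continuous_on_subset order_trans)

lemma tendsto_f: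
  assumes "\<And>n. g n \<in> {z..b}" "g \<longlonglongrightarrow> x"
  shows "(\<lambda>n. f (g n)) \<longlonglongrightarrow> f x"
proof -
  have "x \<in> {z..b}"
    using closed_sequentially[of "{z..b}" g x] assms by auto
  then show ?thesis
    using assms by (intro continuous_on_tendsto_compose[OF cont[of z b]]) auto
qed

text \<open>The extremal choice of preimages makes both branches strictly monotone.\<close>

definition \<phi> :: "bool \<Rightarrow> real \<Rightarrow> real" where
  "\<phi> a y = (if a then Sup {x \<in> {c..b}. f x = y} else Inf {x \<in> {z..c}. f x = y})"

text \<open>Compactness makes the supremum and the infimum in \<open>\<phi>\<close> preimages
  themselves.\<close>

lemma compact_fibre:
  assumes "{p..q} \<subseteq> {z..b}"
  shows "compact {x \<in> {p..q}. f x = y}"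
proof -
  have "closed ({p..q} \<inter> f -` {y})"
    using cont[OF assms] by (intro continuous_closed_preimage) auto
  moreover have "{x \<in> {p..q}. f x = y} = {p..q} \<inter> ({p..q} \<inter> f -` {y})"
    by auto
  ultimately show ?thesis
    by (metis compact_Icc compact_Int_closed)
qed

lemma \<phi>_True:
  assumes "y \<in> {z..b}"
  shows "\<phi> True y \<in> {c..b}" "f (\<phi> True y) = y" "\<And>x. x \<in> {c..b} \<Longrightarrow> f x = y \<Longrightarrow> x \<le> \<phi> True y"
proof -
  let ?A = "{x \<in> {c..b}. f x = y}"
  have c: "compact ?A"
    using z_less_c by (intro compact_fibre) auto
  obtain x where "c \<le> x" "x \<le> b" "f x = y"
    using IVT2'[of f b y c] assms c_less_b z_less_c f_b f_c cont[of c b] by auto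
  then have "?A \<noteq> {}" by auto
  with c have "Sup ?A \<in> ?A"
    by (intro closed_contains_Sup compact_imp_closed) (auto intro: bdd_above.I2)
  moreover have "x \<le> Sup ?A" if "x \<in> ?A" for x
    using that c by (intro cSup_upper bounded_imp_bdd_above compact_imp_bounded) auto
  ultimately show "\<phi> True y \<in> {c..b}" "f (\<phi> True y) = y" "\<And>x. x \<in> {c..b} \<Longrightarrow> f x = y \<Longrightarrow> x \<le> \<phi> True y"
    by (auto simp: \<phi>_def)
qed

lemma \<phi>_False:
  assumes "y \<in> {z..b}"
  shows "\<phi> False y \<in> {z..c}" "f (\<phi> False y) = y" "\<And>x. x \<in> {z..c} \<Longrightarrow> f x = y \<Longrightarrow> \<phi> False y \<le> x"
proof -
  let ?A = "{x \<in> {z..c}. f x = y}"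
  have c: "compact ?A"
    using c_less_b by (intro compact_fibre) auto
  obtain x where "z \<le> x" "x \<le> c" "f x = y"
    using IVT'[of f z y c] assms c_less_b z_less_c f_z f_c cont[of z c] by auto
  then have "?A \<noteq> {}" by auto
  with c have "Inf ?A \<in> ?A"
    by (intro closed_contains_Inf compact_imp_closed) (auto intro: bdd_below.I2)
  moreover have "Inf ?A \<le> x" if "x \<in> ?A" for x
    using that c by (intro cInf_lower bounded_imp_bdd_below compact_imp_bounded) auto
  ultimately show "\<phi> False y \<in> {z..c}" "f (\<phi> False y) = y" "\<And>x. x \<in> {z..c} \<Longrightarrow> f x = y \<Longrightarrow> \<phi> False y \<le> x"
    by (auto simp: \<phi>_def)
qed

lemma \<phi>_mem: "y \<in> {z..b} \<Longrightarrow> \<phi> a y \<in> {z..b}"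
  using \<phi>_True[of y] \<phi>_False[of y] z_less_c c_less_b by (cases a) auto

lemma f_\<phi>: "y \<in> {z..b} \<Longrightarrow> f (\<phi> a y) = y"
  using \<phi>_True[of y] \<phi>_False[of y] by (cases a) auto

text \<open>To the right of the last preimage of \<open>y'\<close>, \<open>f\<close> descends from
  \<open>y'\<close> to \<open>f b = z\<close> and so takes the smaller value \<open>y\<close> there.
  Hence the last preimage of \<open>y\<close> lies further right.\<close>

lemma \<phi>_True_antimono:
  assumes "y \<in> {z..b}" "y' \<in> {z..b}" "y < y'"
  shows "\<phi> True y' < \<phi> True y"
proof (rule ccontr)
  assume neg: "\<not> ?thesis"
  let ?q = "\<phi> True y'"
  have q: "?q \<in> {c..b}" "f ?q = y'"
    using \<phi>_True[of y'] assms by auto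
  obtain x where x: "?q \<le> x" "x \<le> b" "f x = y"
    using IVT2'[of f b y ?q] q assms f_b cont[of ?q b] z_less_c by auto
  then have "x \<le> \<phi> True y"
    using \<phi>_True(3)[of y x] assms q by auto
  with x neg have "x = ?q" by auto
  with x q assms show False by auto
qed

text \<open>To the left of the first preimage of \<open>y'\<close>, \<open>f\<close> climbs from
  \<open>f z = z\<close> to \<open>y'\<close> and passes the value \<open>y\<close> on the
  way.\<close>

lemma \<phi>_False_mono:
  assumes "y \<in> {z..b}" "y' \<in> {z..b}" "y < y'"
  shows "\<phi> False y < \<phi> False y'"
proof (rule ccontr)
  assume neg: "\<not> ?thesis"
  let ?q = "\<phi> False y'"
  have q: "?q \<in> {z..c}" "f ?q = y'"
    using \<phi>_False[of y'] assms by auto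
  obtain x where x: "z \<le> x" "x \<le> ?q" "f x = y"
    using IVT'[of f z y ?q] q assms f_z cont[of z ?q] c_less_b by auto
  then have "\<phi> False y \<le> x"
    using \<phi>_False(3)[of y x] assms q by auto
  with x neg have "x = ?q" by auto
  with x q assms show False by auto
qed

lemma \<phi>_False_z: "\<phi> False z = z"
  using \<phi>_False(1)[of z] \<phi>_False(3)[of z z] f_z z_less_c c_less_b by auto

lemma \<phi>_True_z: "\<phi> True z = b"
  using \<phi>_True(1)[of z] \<phi>_True(3)[of z b] f_b z_less_c c_less_b by auto

section \<open>Composed branches and their cylinders\<close>

definition \<Phi> :: "bool list \<Rightarrow> real \<Rightarrow> real" where
  "\<Phi> w = foldr \<phi> w"

lemma \<Phi>_simps [simp]: "\<Phi> [] = id" "\<Phi> (a # w) = \<phi> a \<circ> \<Phi> w" "\<Phi> (u @ v) = \<Phi> u \<circ> \<Phi> v"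
  by (auto simp: \<Phi>_def fun_eq_iff)

lemma \<Phi>_mem: "y \<in> {z..b} \<Longrightarrow> \<Phi> w y \<in> {z..b}"
  using \<phi>_mem by (induction w) auto

lemma z_mem: "z \<in> {z..b}" and b_mem: "b \<in> {z..b}"
  using z_less_c c_less_b by auto

text \<open>The head of a word is its outermost branch, so each application of \<open>f\<close>
  strips one letter: \<open>f\<close> acts on words as the shift.\<close>

lemma f_pow_\<Phi>:
  assumes "y \<in> {z..b}" "i \<le> length w"
  shows "(f ^^ i) (\<Phi> w y) = \<Phi> (drop i w) y"
  using assms(2)
proof (induction i arbitrary: w)
  case (Suc i)
  then obtain a v where "w = a # v" by (cases w) auto
  with Suc show ?case
    using assms(1) \<Phi>_mem[of y v] by (simp add: funpow_Suc_right f_\<phi> del: funpow.simps)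
qed simp

text \<open>Every \<open>True\<close> reverses the order and every \<open>False\<close> keeps it, so
  the direction depends on the parity of the number of \<open>True\<close> letters.\<close>

lemma \<Phi>_monotone:
  "monotone_on {z..b} (<) (<) (\<Phi> w) \<or> monotone_on {z..b} (<) (>) (\<Phi> w)"
proof (induction w)
  case (Cons a w)
  have "monotone_on {z..b} (<) (<) (\<phi> a) \<or> monotone_on {z..b} (<) (>) (\<phi> a)"
    using \<phi>_True_antimono \<phi>_False_mono by (cases a) (auto simp: monotone_on_def)
  with Cons show ?case
    using \<Phi>_mem by (auto simp: monotone_on_def)
qed (auto simp: monotone_on_def)

text \<open>The branches may jump, so the image of \<open>{z..b}\<close> under
  \<open>\<Phi> w\<close> need not be an interval; this is its convex hull. An unordered segment is
  used because the direction of \<open>\<Phi> w\<close> varies.\<close>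

definition K :: "bool list \<Rightarrow> real set" where
  "K w = closed_segment (\<Phi> w z) (\<Phi> w b)"

lemma \<Phi>_closed_segment:
  assumes "p \<in> {z..b}" "q \<in> {z..b}" "y \<in> closed_segment p q"
  shows "\<Phi> w y \<in> closed_segment (\<Phi> w p) (\<Phi> w q)"
proof -
  have y: "y \<in> {z..b}"
    using assms by (auto simp: closed_segment_eq_real_ivl split: if_splits)
  consider "y = p" | "y = q" | "p < y" "y < q" | "q < y" "y < p"
    using assms by (force simp: closed_segment_eq_real_ivl split: if_splits)
  then have "\<Phi> w p = \<Phi> w y \<or> \<Phi> w y = \<Phi> w q \<or>
      (\<Phi> w p < \<Phi> w y \<and> \<Phi> w y < \<Phi> w q) \<or> (\<Phi> w p > \<Phi> w y \<and> \<Phi> w y > \<Phi> w q)"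
    by cases (use \<Phi>_monotone[of w] assms(1,2) y in \<open>auto simp: monotone_on_def simp del: atLeastAtMost_iff\<close>)
  then show ?thesis
    by (auto simp: closed_segment_eq_real_ivl)
qed

lemma \<Phi>_K: "y \<in> {z..b} \<Longrightarrow> \<Phi> w y \<in> K w"
  unfolding K_def using z_mem b_mem by (intro \<Phi>_closed_segment) (auto simp: closed_segment_eq_real_ivl)

lemma K_append: "K (u @ v) \<subseteq> K u"
  unfolding K_def
  using \<Phi>_K[OF \<Phi>_mem[OF z_mem], of u v] \<Phi>_K[OF \<Phi>_mem[OF b_mem], of u v]
  by (intro closed_segment_subset) (simp_all add: K_def)

lemma K_subset: "K w \<subseteq> {z..b}"
  using K_append[of "[]" w] z_less_c c_less_b by (simp add: K_def closed_segment_eq_real_ivl)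

lemma K_Cons: "K (a # w) \<subseteq> (if a then {c..b} else {z..c})"
proof -
  have "K [a] \<subseteq> (if a then {c..b} else {z..c})"
    using \<phi>_True(1) \<phi>_False(1) z_mem b_mem
    by (auto simp: K_def closed_segment_eq_real_ivl split: if_splits)
  then show ?thesis using K_append[of "[a]" w] by auto
qed

text \<open>The ranges of the two branches lie on opposite sides of \<open>c\<close>, and the
  monotone map \<open>\<Phi> w\<close> keeps them apart, whichever its direction. The hulls can
  share only a common endpoint, the image of \<open>\<phi> False b\<close> and
  \<open>\<phi> True b\<close>.\<close>

lemma siblings_touch:
  assumes "x \<in> K (w @ [False])" "x \<in> K (w @ [True])" "y \<in> K (w @ [False])" "y \<in> K (w @ [True])"
  shows "x = y"
proof -
  let ?l = "\<Phi> w (\<phi> False z)" and ?l' = "\<Phi> w (\<phi> False b)" and ?r = "\<Phi> w (\<phi> True b)" and ?r' = "\<Phi> w (\<phi> True z)"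
  have o: "\<phi> False z \<le> \<phi> False b" "\<phi> False b \<le> \<phi> True b" "\<phi> True b \<le> \<phi> True z"
    using \<phi>_False_mono[of z b] \<phi>_True_antimono[of z b] \<phi>_True(1)[of b] \<phi>_False(1)[of b] z_less_c c_less_b
    by auto
  have m: "\<phi> False z \<in> {z..b}" "\<phi> False b \<in> {z..b}" "\<phi> True b \<in> {z..b}" "\<phi> True z \<in> {z..b}"
    using \<phi>_mem z_mem b_mem by auto
  have K: "K (w @ [False]) = closed_segment ?l ?l'" "K (w @ [True]) = closed_segment ?r' ?r"
    by (simp_all add: K_def)
  show ?thesis
    using \<Phi>_monotone[of w]
  proof
    assume a: "monotone_on {z..b} (<) (<) (\<Phi> w)"
    have mono: "\<Phi> w p \<le> \<Phi> w q" if "p \<in> {z..b}" "q \<in> {z..b}" "p \<le> q" for p q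
      using monotone_onD[OF a that(1,2)] that(3) by (cases "p = q") auto
    have "?l \<le> ?l'" "?l' \<le> ?r" "?r \<le> ?r'"
      using mono[OF m(1,2) o(1)] mono[OF m(2,3) o(2)] mono[OF m(3,4) o(3)] by simp_all
    then show ?thesis
      using assms unfolding K by (simp add: closed_segment_eq_real_ivl split: if_splits)
  next
    assume a: "monotone_on {z..b} (<) (>) (\<Phi> w)"
    have mono: "\<Phi> w q \<le> \<Phi> w p" if "p \<in> {z..b}" "q \<in> {z..b}" "p \<le> q" for p q
      using monotone_onD[OF a that(1,2)] that(3) by (cases "p = q") auto
    have "?l' \<le> ?l" "?r \<le> ?l'" "?r' \<le> ?r"
      using mono[OF m(1,2) o(1)] mono[OF m(2,3) o(2)] mono[OF m(3,4) o(3)] by simp_all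
    then show ?thesis
      using assms unfolding K by (simp add: closed_segment_eq_real_ivl split: if_splits)
  qed
qed

section \<open>Points coded by sequences\<close>

definition pre :: "(nat \<Rightarrow> bool) \<Rightarrow> nat \<Rightarrow> bool list" where
  "pre s n = map s [0..<n]"

lemma pre_Suc: "pre s (Suc n) = s 0 # pre (shift 1 s) n"
  by (simp add: pre_def map_upt_Suc del: upt_Suc)

lemma pre_Suc': "pre s (Suc n) = pre s n @ [s n]"
  by (simp add: pre_def)

lemma K_pre_mono: "m \<le> n \<Longrightarrow> K (pre s n) \<subseteq> K (pre s m)"
  by (induction rule: dec_induct) (use K_append in \<open>auto simp: pre_Suc'\<close>)

text \<open>Convergence of both ends is demanded, rather than membership of \<open>x\<close> in all
  cylinders: a hull may contain points outside the range of the branch, on which \<open>f\<close>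
  need not follow the shift. Limits of branch values are carried along by continuity of
  \<open>f\<close>.\<close>

definition codes :: "(nat \<Rightarrow> bool) \<Rightarrow> real \<Rightarrow> bool" where
  "codes s x \<longleftrightarrow> (\<lambda>n. \<Phi> (pre s n) z) \<longlonglongrightarrow> x \<and> (\<lambda>n. \<Phi> (pre s n) b) \<longlonglongrightarrow> x"

lemma codes_K:
  assumes "codes s x"
  shows "x \<in> K (pre s n)"
proof (rule Lim_in_closed_set)
  show "closed (K (pre s n))" by (simp add: K_def)
  show "(\<lambda>n. \<Phi> (pre s n) z) \<longlonglongrightarrow> x" using assms by (simp add: codes_def)
  show "\<forall>\<^sub>F m in sequentially. \<Phi> (pre s m) z \<in> K (pre s n)"
    using eventually_ge_at_top[of n] by eventually_elim (use \<Phi>_K[OF z_mem] K_pre_mono in blast)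
qed simp

lemma codes_f:
  assumes "codes s x"
  shows "codes (shift 1 s) (f x)"
proof -
  have "(\<lambda>n. \<Phi> (pre (shift 1 s) n) y) \<longlonglongrightarrow> f x"
    if y: "y \<in> {z..b}" and lim: "(\<lambda>n. \<Phi> (pre s n) y) \<longlonglongrightarrow> x" for y
  proof -
    have "(\<lambda>n. f (\<Phi> (pre s (Suc n)) y)) \<longlonglongrightarrow> f x"
      using LIMSEQ_Suc[OF lim] \<Phi>_mem[OF y] by (intro tendsto_f)
    then show ?thesis
      using \<Phi>_mem[OF y] by (simp add: pre_Suc f_\<phi>)
  qed
  then show ?thesis
    using assms z_mem b_mem by (simp add: codes_def)
qed

lemma codes_funpow: "codes s x \<Longrightarrow> codes (shift k s) ((f ^^ k) x)"
proof (induction k)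
  case (Suc k)
  then show ?case using codes_f[of "shift k s"] by simp
qed simp

text \<open>This is weaker than having a code: the periodic points found below may be endpoints of a
  nondegenerate intersection of cylinders.\<close>

definition approximable :: "real \<Rightarrow> bool" where
  "approximable y \<longleftrightarrow> (\<forall>e>0. \<exists>w. K w \<subseteq> ball y e)"

lemma codes_K_small:
  assumes "codes s x" "e > 0"
  shows "\<exists>n. K (pre s n) \<subseteq> ball x e"
proof -
  have "\<forall>\<^sub>F n in sequentially. \<Phi> (pre s n) z \<in> ball x e \<and> \<Phi> (pre s n) b \<in> ball x e"
    using assms by (intro eventually_conj topological_tendstoD) (auto simp: codes_def)
  then obtain n where "\<Phi> (pre s n) z \<in> ball x e" "\<Phi> (pre s n) b \<in> ball x e"
    by (auto simp: eventually_sequentially)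
  then show ?thesis
    unfolding K_def by (intro exI[of _ n] closed_segment_subset) auto
qed

lemma codes_approximable: "codes s x \<Longrightarrow> approximable x"
  unfolding approximable_def using codes_K_small by blast

text \<open>The lower ends are constantly \<open>z\<close>. The upper ends decrease, and continuity
  of \<open>f\<close> makes their limit a fixed point in \<open>{z..c}\<close>, which
  \<open>no_fixed\<close> identifies as \<open>z\<close>.\<close>

lemma codes_zeros: "codes (\<lambda>_. False) z"
proof -
  have pre: "pre (\<lambda>_. False) n = replicate n False" for n
    by (simp add: pre_def map_replicate_const)
  let ?h = "\<lambda>n. \<Phi> (replicate n False) b"
  have h_mem: "?h n \<in> {z..b}" for n using \<Phi>_mem b_mem by blast
  have "?h (Suc n) \<le> ?h n" for n
  proof (induction n)
    case 0
    then show ?case using \<phi>_False(1)[OF b_mem] c_less_b by simp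
  next
    case (Suc n)
    then show ?case
      using \<phi>_False_mono[OF h_mem[of "Suc n"] h_mem[of n]] by (cases "?h (Suc n) = ?h n") auto
  qed
  then have "decseq ?h" by (rule decseq_SucI)
  then obtain L where L: "?h \<longlonglongrightarrow> L"
    using decseq_convergent[of ?h z] h_mem by (metis atLeastAtMost_iff)
  have "(\<lambda>n. f (?h (Suc n))) \<longlonglongrightarrow> f L"
    using h_mem LIMSEQ_Suc[OF L] by (intro tendsto_f)
  then have "?h \<longlonglongrightarrow> f L"
    using f_\<phi> h_mem by simp
  then have "f L = L" using L LIMSEQ_unique by blast
  moreover have "L \<in> {z..c}"
  proof (rule Lim_in_closed_set[OF _ _ _ LIMSEQ_Suc[OF L]])
    show "\<forall>\<^sub>F n in sequentially. ?h (Suc n) \<in> {z..c}"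
      using \<phi>_False(1) h_mem by (intro always_eventually) simp
  qed auto
  ultimately have "L = z" using no_fixed[of L] by force
  moreover have "\<Phi> (replicate n False) z = z" for n
    by (induction n) (simp_all add: \<phi>_False_z)
  ultimately show ?thesis using L by (simp add: codes_def pre)
qed

text \<open>One end is constantly \<open>\<phi> True z = b\<close>. Since \<open>\<phi> True\<close>
  may be discontinuous, the limit of the other end is found through \<open>f\<close>: it is a
  preimage of \<open>z\<close> in \<open>{c..b}\<close>, hence \<open>b\<close> by
  \<open>no_preimage\<close>.\<close>

lemma codes_one_zeros: "codes (\<lambda>i. i = 0) b"
proof -
  let ?h = "\<lambda>n. \<Phi> (pre (\<lambda>_. False) n) b"
  have h_mem: "?h n \<in> {z..b}" for n using \<Phi>_mem b_mem by blast
  have h: "?h \<longlonglongrightarrow> z" using codes_zeros by (simp add: codes_def)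
  have z0: "\<Phi> (pre (\<lambda>_. False) n) z = z" for n
    by (induction n) (simp_all add: pre_Suc \<phi>_False_z, simp add: pre_def)
  let ?g = "\<lambda>n. \<phi> True (?h n)"
  have g_mem: "?g n \<in> {c..b}" for n using \<phi>_True(1) h_mem by blast
  have "?g n \<le> ?g (Suc n)" for n
  proof -
    have "?h (Suc n) \<le> ?h n"
      using K_pre_mono[of n "Suc n" "\<lambda>_. False"] \<Phi>_K[OF b_mem, of "pre (\<lambda>_. False) (Suc n)"] h_mem[of n]
      by (auto simp: K_def z0 closed_segment_eq_real_ivl)
    then show ?thesis
      using \<phi>_True_antimono[OF h_mem[of "Suc n"] h_mem[of n]] by (cases "?h (Suc n) = ?h n") auto
  qed
  then have "incseq ?g" by (rule incseq_SucI)
  then obtain L where L: "?g \<longlonglongrightarrow> L"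
    using incseq_convergent[of ?g b] g_mem by (metis atLeastAtMost_iff)
  have "(\<lambda>n. f (?g n)) \<longlonglongrightarrow> f L"
    using \<phi>_mem h_mem L by (intro tendsto_f) auto
  then have "f L = z"
    using f_\<phi> h_mem h LIMSEQ_unique by simp
  moreover have "L \<in> {c..b}"
    using closed_sequentially[of "{c..b}" ?g L] L g_mem by auto
  ultimately have "L = b" using no_preimage[of L] by force
  have "(\<lambda>n. \<Phi> (pre (\<lambda>i. i = 0) (Suc n)) y) = (\<lambda>n. \<phi> True (\<Phi> (pre (\<lambda>_. False) n) y))" for y
    by (simp add: pre_Suc)
  then have "(\<lambda>n. \<Phi> (pre (\<lambda>i. i = 0) (Suc n)) b) \<longlonglongrightarrow> b" "(\<lambda>n. \<Phi> (pre (\<lambda>i. i = 0) (Suc n)) z) \<longlonglongrightarrow> b"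
    using L \<open>L = b\<close> by (simp_all add: z0 \<phi>_True_z)
  then show ?thesis
    unfolding codes_def
    using LIMSEQ_imp_Suc[of "\<lambda>n. \<Phi> (pre (\<lambda>i. i = 0) n) b"]
      LIMSEQ_imp_Suc[of "\<lambda>n. \<Phi> (pre (\<lambda>i. i = 0) n) z"] by simp
qed

text \<open>If the nested cylinders of \<open>s\<close> do not shrink to a point, they share a
  nonempty open interval. Such intervals are disjoint for different sequences, and the line has room
  for only countably many.\<close>

lemma uncoded_countable: "countable {s. \<nexists>x. codes s x}"
proof -
  let ?B = "{s. \<nexists>x. codes s x}"
  have ex: "\<exists>l r. l < r \<and> (\<forall>n. {l<..<r} \<subseteq> K (pre s n))" if "s \<in> ?B" for s
  proof -
    define p where "p n = min (\<Phi> (pre s n) z) (\<Phi> (pre s n) b)" for n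
    define q where "q n = max (\<Phi> (pre s n) z) (\<Phi> (pre s n) b)" for n
    have K: "K (pre s n) = {p n..q n}" and le: "p n \<le> q n" for n
      by (auto simp: K_def p_def q_def closed_segment_eq_real_ivl)
    have sub: "{p (Suc n)..q (Suc n)} \<subseteq> {p n..q n}" for n
      using K_pre_mono[OF le_SucI[OF order_refl], of s n] by (simp only: K)
    have step: "p n \<le> p (Suc n)" "q (Suc n) \<le> q n" for n
      using sub[of n] le[of "Suc n"] unfolding atLeastatMost_subset_iff by auto
    have inc: "incseq p" using step(1) by (rule incseq_SucI)
    have dec: "decseq q" using step(2) by (rule decseq_SucI)
    have bounds: "p n \<le> b" "z \<le> q n" for n
      using \<Phi>_mem[OF z_mem, of "pre s n"] by (auto simp: p_def q_def)
    obtain l where l: "p \<longlonglongrightarrow> l" "\<forall>n. p n \<le> l"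
      using incseq_convergent[OF inc] bounds(1) by blast
    obtain r where r: "q \<longlonglongrightarrow> r" "\<forall>n. r \<le> q n"
      using decseq_convergent[OF dec] bounds(2) by blast
    have "l \<le> r"
      by (rule LIMSEQ_le[OF l(1) r(1)]) (use le in auto)
    moreover have "l \<noteq> r"
    proof
      assume "l = r"
      have "(\<lambda>n. \<Phi> (pre s n) y) \<longlonglongrightarrow> l" if "\<And>n. p n \<le> \<Phi> (pre s n) y \<and> \<Phi> (pre s n) y \<le> q n" for y
        by (rule tendsto_sandwich[OF _ _ l(1) r(1)[folded \<open>l = r\<close>]]) (use that in auto)
      then have "codes s l"
        unfolding codes_def by (simp add: p_def q_def)
      then show False using that by blast
    qed
    ultimately have "l < r" by simp
    moreover have "{l<..<r} \<subseteq> K (pre s n)" for n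
      unfolding K using spec[OF l(2), of n] spec[OF r(2), of n] by (auto intro: order_trans)
    ultimately show ?thesis by blast
  qed
  define U where "U s = (SOME V. \<exists>l r. V = {l<..<r} \<and> l < r \<and> (\<forall>n. V \<subseteq> K (pre s n)))" for s
  have U: "\<exists>l r. U s = {l<..<r} \<and> l < r \<and> (\<forall>n. U s \<subseteq> K (pre s n))" if "s \<in> ?B" for s
    unfolding U_def using someI_ex[of "\<lambda>V. \<exists>l r. V = {l<..<r} \<and> l < r \<and> (\<forall>n. V \<subseteq> K (pre s n))"]
    using ex[OF that] by blast
  have disj: "U s \<inter> U t = {}" if sB: "s \<in> ?B" and tB: "t \<in> ?B" and "s \<noteq> t" for s t
  proof (rule ccontr)
    assume ne: "U s \<inter> U t \<noteq> {}"
    obtain l r where s: "U s = {l<..<r}" "\<And>n. U s \<subseteq> K (pre s n)" using U[OF sB] by blast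
    obtain l' r' where t: "U t = {l'<..<r'}" "\<And>n. U t \<subseteq> K (pre t n)" using U[OF tB] by blast
    \<comment> \<open>Sibling cylinders may share one point, so two distinct common points are
      needed for a contradiction at the first disagreement.\<close>
    have eq: "U s \<inter> U t = {max l l'<..<min r r'}" using s t by auto
    then have "max l l' < min r r'" using ne by auto
    then obtain x where "max l l' < x" "x < min r r'" using dense by blast
    moreover then obtain y where "x < y" "y < min r r'" using dense by blast
    ultimately have xy: "x \<in> U s \<inter> U t" "y \<in> U s \<inter> U t" "x \<noteq> y"
      unfolding eq by auto
    define p where "p = (LEAST p. s p \<noteq> t p)"
    have p: "s p \<noteq> t p"
      unfolding p_def using LeastI_ex[of "\<lambda>p. s p \<noteq> t p"] \<open>s \<noteq> t\<close> by auto
    have "s i = t i" if "i < p" for i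
      using that not_less_Least unfolding p_def by blast
    then have "pre s p = pre t p" by (simp add: pre_def)
    then have "K (pre s (Suc p)) = K (pre s p @ [s p])" "K (pre t (Suc p)) = K (pre s p @ [\<not> s p])"
      using p by (auto simp: pre_Suc')
    moreover have "x \<in> K (pre s (Suc p))" "y \<in> K (pre s (Suc p))" "x \<in> K (pre t (Suc p))" "y \<in> K (pre t (Suc p))"
      using xy s(2) t(2) by blast+
    ultimately have "x = y"
      using siblings_touch[of x "pre s p" y] by (cases "s p") auto
    then show False using xy by simp
  qed
  have ne: "U s \<noteq> {}" if "s \<in> ?B" for s
    using U[OF that] by auto
  have "inj_on U ?B"
  proof (rule inj_onI, rule ccontr)
    fix s t assume "s \<in> ?B" "t \<in> ?B" "U s = U t" "s \<noteq> t"
    then show False using disj[of s t] ne[of s] by simp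
  qed
  moreover have "countable (U ` ?B)"
  proof (rule countable_disjoint_open_subsets)
    show "open V" if "V \<in> U ` ?B" for V using that U by fastforce
    show "disjoint (U ` ?B)" using disj by (auto simp: disjoint_def)
  qed
  ultimately show ?thesis using countable_image_inj_on by blast
qed

section \<open>The scrambled set\<close>

definition S :: "real set" where
  "S = {x. \<exists>\<alpha> k. codes (shift k (code \<alpha>)) x}"

lemma SE:
  assumes "x \<in> S"
  obtains \<alpha> k where "codes (shift k (code \<alpha>)) x"
  using assms by (auto simp: S_def)

text \<open>Every finite word occurs arbitrarily late in a code, and reading it places the orbit in
  the corresponding cylinder.\<close>

lemma S_visits:
  assumes "x \<in> S"
  shows "\<exists>m\<ge>N. (f ^^ m) x \<in> K w"
proof -
  obtain \<alpha> k where s: "codes (shift k (code \<alpha>)) x" using assms by (rule SE)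
  obtain m where m: "m \<ge> N + k" "\<And>i. i < length w \<Longrightarrow> code \<alpha> (m + i) = w ! i"
    using code_word_occurs[of "N + k" w \<alpha>] by metis
  have "pre (shift (m - k) (shift k (code \<alpha>))) (length w) = w"
    using m by (intro nth_equalityI) (auto simp: pre_def)
  then have "(f ^^ (m - k)) x \<in> K w"
    using codes_K[OF codes_funpow[OF s, of "m - k"], of "length w"] by simp
  then show ?thesis using m(1) by (intro exI[of _ "m - k"]) auto
qed

lemma approximable_omega:
  assumes "x \<in> S" "approximable y"
  shows "y \<in> omega_limit f x"
proof (rule omega_limitI)
  fix e :: real and N :: nat assume "e > 0"
  then obtain w where "K w \<subseteq> ball y e" using assms(2) by (auto simp: approximable_def)
  then show "\<exists>m\<ge>N. \<bar>(f ^^ m) x - y\<bar> < e"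
    using S_visits[OF assms(1), of N w] by (force simp: dist_real_def abs_minus_commute)
qed

lemma approximable_z: "approximable z" and approximable_b: "approximable b"
  using codes_approximable codes_zeros codes_one_zeros by blast+

lemma S_approximable: "x \<in> S \<Longrightarrow> approximable x"
  using codes_approximable by (auto simp: S_def)

lemma S_subset: "S \<subseteq> {z..b}"
  using codes_K K_subset by (fastforce simp: S_def)

text \<open>This is why \<open>S\<close> admits all shifts of the codes: \<open>f\<close> passes
  from one shift to the next.\<close>

lemma S_invariant: "f ` S \<subseteq> S"
proof
  fix y assume "y \<in> f ` S"
  then obtain \<alpha> k x where "y = f x" "codes (shift k (code \<alpha>)) x" by (auto simp: S_def)
  then have "codes (shift (Suc k) (code \<alpha>)) y" using codes_f by fastforce
  then show "y \<in> S" unfolding S_def by blast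
qed

text \<open>Where two codes of \<open>x\<close> disagree, the orbit lies on both sides of
  \<open>c\<close>, hence at \<open>c\<close>. It then goes to \<open>b\<close>, to
  \<open>z\<close>, and stays there, although an orbit from \<open>S\<close> must keep visiting
  \<open>K [True]\<close>.\<close>

lemma codes_inject:
  assumes "codes s x" "codes t x" "x \<in> S"
  shows "s = t"
proof
  fix p
  show "s p = t p"
  proof (rule ccontr)
    assume neq: "s p \<noteq> t p"
    let ?y = "(f ^^ p) x"
    have "?y \<in> K [s p]" "?y \<in> K [t p]"
      using codes_K[OF codes_funpow[OF assms(1), of p], of 1] codes_K[OF codes_funpow[OF assms(2), of p], of 1]
      by (auto simp: pre_def)
    then have "?y = c"
      using K_Cons[of "s p" "[]"] K_Cons[of "t p" "[]"] neq by (cases "s p"; cases "t p") force+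
    then have 0: "(f ^^ (p + 2)) x = z" using f_c f_b by simp
    obtain m where m: "m \<ge> p + 2" "(f ^^ m) x \<in> K [True]" using S_visits[OF assms(3)] by blast
    have "(f ^^ m) x = (f ^^ (m - (p + 2))) ((f ^^ (p + 2)) x)"
      using m(1) by (metis comp_apply funpow_add le_add_diff_inverse2)
    then have "(f ^^ m) x = z" unfolding 0 using funpow_fixed f_z by metis
    then show False using m(2) K_Cons[of True "[]"] z_less_c by auto
  qed
qed

lemma code_inject: "code \<alpha> = code \<beta> \<Longrightarrow> \<alpha> = \<beta>"
  using shifted_codes_differ[of 0 0 \<alpha> \<beta>] by metis

text \<open>All but countably many \<open>\<alpha>\<close> have a point coded by
  \<open>code \<alpha>\<close>, and different \<open>\<alpha>\<close> give different points.\<close>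

lemma uncountable_S: "uncountable S"
proof
  assume "countable S"
  define X where "X = {\<alpha>. \<exists>x. codes (code \<alpha>) x}"
  define g where "g \<alpha> = (SOME x. codes (code \<alpha>) x)" for \<alpha>
  have g: "codes (code \<alpha>) (g \<alpha>)" if "\<alpha> \<in> X" for \<alpha>
    using that someI_ex[of "codes (code \<alpha>)"] by (simp add: X_def g_def)
  then have gS: "g \<alpha> \<in> S" if "\<alpha> \<in> X" for \<alpha>
    unfolding S_def using that by (intro CollectI exI[of _ \<alpha>] exI[of _ 0]) simp
  have "inj_on g X"
    by (rule inj_onI) (metis g gS codes_inject code_inject)
  moreover have "countable (g ` X)"
    using \<open>countable S\<close> gS by (meson countable_subset image_subsetI)
  ultimately have "countable X" using countable_image_inj_on by blast
  moreover have "countable (- X)"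
  proof -
    have "code ` (- X) \<subseteq> {s. \<nexists>x. codes s x}" by (auto simp: X_def)
    then have "countable (code ` (- X))" using uncoded_countable countable_subset by blast
    moreover have "inj_on code (- X)" using code_inject by (auto simp: inj_on_def)
    ultimately show ?thesis using countable_image_inj_on by blast
  qed
  ultimately have "countable (X \<union> - X)" by blast
  then show False using uncountable_UNIV_nat_bool by simp
qed

text \<open>At time \<open>n\<close> the pair is nearly at distance \<open>b - z\<close>, which
  serves the upper limit; one step later both points are near \<open>z\<close>, which serves the
  lower limit.\<close>

lemma pairs_in_S:
  assumes "x \<in> S" "y \<in> S" "x \<noteq> y" "e > 0"
  obtains n where "n \<ge> N" "(f ^^ n) x \<in> ball b e \<and> (f ^^ n) y \<in> ball z e \<or> (f ^^ n) x \<in> ball z e \<and> (f ^^ n) y \<in> ball b e"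
    "(f ^^ Suc n) x \<in> ball z e" "(f ^^ Suc n) y \<in> ball z e"
proof -
  obtain \<alpha> i where s: "codes (shift i (code \<alpha>)) x" using assms(1) by (rule SE)
  obtain \<beta> j where t: "codes (shift j (code \<beta>)) y" using assms(2) by (rule SE)
  have "i \<noteq> j \<or> \<alpha> \<noteq> \<beta>"
    using s t assms(3) LIMSEQ_unique by (auto simp: codes_def)
  obtain L0 where L0: "K (pre (\<lambda>_. False) L0) \<subseteq> ball z e"
    using codes_K_small[OF codes_zeros assms(4)] by blast
  obtain L1 where L1: "K (pre (\<lambda>i. i = 0) L1) \<subseteq> ball b e"
    using codes_K_small[OF codes_one_zeros assms(4)] by blast
  let ?L = "max L0 L1"
  obtain n where n: "n \<ge> N" "shift i (code \<alpha>) n \<noteq> shift j (code \<beta>) n"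
    "\<And>r. 0 < r \<Longrightarrow> r \<le> ?L \<Longrightarrow> \<not> shift i (code \<alpha>) (n + r) \<and> \<not> shift j (code \<beta>) (n + r)"
    using shifted_codes_differ[OF \<open>i \<noteq> j \<or> \<alpha> \<noteq> \<beta>\<close>] by metis
  \<comment> \<open>A digit 1 followed by zeros starts like the code of \<open>b\<close>, a digit 0
    followed by zeros like the code of \<open>z\<close>.\<close>
  have *: "(f ^^ Suc n) x \<in> ball z e" "(f ^^ n) x \<in> (if s n then ball b e else ball z e)"
    if s: "codes s x" and zero: "\<And>r. 0 < r \<Longrightarrow> r \<le> ?L \<Longrightarrow> \<not> s (n + r)" for s x
  proof -
    have "pre (shift (Suc n) s) L0 = pre (\<lambda>_. False) L0"
      using zero[of "Suc _"] by (auto simp: pre_def)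
    then show "(f ^^ Suc n) x \<in> ball z e"
      using codes_K[OF codes_funpow[OF s, of "Suc n"], of L0] L0 by auto
    have "pre (shift n s) L1 = pre (\<lambda>i. i = 0) L1" if "s n"
      using zero that by (auto simp: pre_def) (metis gr0I less_imp_le max.coboundedI2)
    moreover have "pre (shift n s) L0 = pre (\<lambda>_. False) L0" if "\<not> s n"
      using zero that by (auto simp: pre_def) (metis add_0_right gr0I less_imp_le max.coboundedI1)
    ultimately show "(f ^^ n) x \<in> (if s n then ball b e else ball z e)"
      using codes_K[OF codes_funpow[OF s, of "n"], of L0] codes_K[OF codes_funpow[OF s, of "n"], of L1] L0 L1
      by (auto split: if_splits)
  qed
  show ?thesis
    using that[OF n(1)] *[OF s] *[OF t] n(2,3) by (smt (verit))
qed

lemma scrambled_S: "scrambled_set I f \<bar>b - z\<bar> S"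
proof -
  have zb: "\<bar>b - z\<bar> = b - z" using z_less_c c_less_b by auto
  have "limsup (\<lambda>n. ereal \<bar>(f ^^ n) x - (f ^^ n) y\<bar>) \<ge> ereal (b - z)"
    "liminf (\<lambda>n. ereal \<bar>(f ^^ n) x - (f ^^ n) y\<bar>) = 0"
    if xy: "x \<in> S" "y \<in> S" "x \<noteq> y" for x y
  proof -
    show "limsup (\<lambda>n. ereal \<bar>(f ^^ n) x - (f ^^ n) y\<bar>) \<ge> ereal (b - z)"
    proof (rule limsup_geI)
      fix e :: real and N :: nat assume "e > 0"
      then obtain n where "n \<ge> N" "(f ^^ n) x \<in> ball b (e/2) \<and> (f ^^ n) y \<in> ball z (e/2) \<or> (f ^^ n) x \<in> ball z (e/2) \<and> (f ^^ n) y \<in> ball b (e/2)"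
        using pairs_in_S[OF xy, of "e/2" N] by auto
      then show "\<exists>n\<ge>N. \<bar>(f ^^ n) x - (f ^^ n) y\<bar> > b - z - e"
        by (intro exI[of _ n]) (auto simp: dist_real_def abs_if field_simps split: if_splits)
    qed
    show "liminf (\<lambda>n. ereal \<bar>(f ^^ n) x - (f ^^ n) y\<bar>) = 0"
    proof (rule liminf_eq_0I)
      fix e :: real and N :: nat assume "e > 0"
      then obtain n where "n \<ge> N" "(f ^^ Suc n) x \<in> ball z (e/2)" "(f ^^ Suc n) y \<in> ball z (e/2)"
        using pairs_in_S[OF xy, of "e/2" N] by auto
      then show "\<exists>n\<ge>N. \<bar>(f ^^ n) x - (f ^^ n) y\<bar> < e"
        by (intro exI[of _ "Suc n"]) (auto simp: dist_real_def abs_if field_simps split: if_splits)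
    qed simp
  qed
  moreover have "limsup (\<lambda>n. ereal \<bar>(f ^^ n) x - (f ^^ n) p\<bar>) \<ge> ereal ((b - z) / 2)"
    if xS: "x \<in> S" and p: "periodic_point I f p" for x p
  proof (rule limsup_geI)
    fix e :: real and N :: nat assume "e > 0"
    obtain m where m: "0 < m" "(f ^^ m) p = p"
      using p by (auto simp: periodic_point_def has_least_period_def)
    text \<open>Along a long block \<open>10\<dots>0\<close> the orbit of \<open>x\<close> is near \<open>b\<close> and, one period of \<open>p\<close> later, near \<open>z\<close>.\<close>
    obtain L where L: "K (pre (\<lambda>_. False) L) \<subseteq> ball z e"
      using codes_K_small[OF codes_zeros \<open>e > 0\<close>] by blast
    obtain L' where L': "K (pre (\<lambda>i. i = 0) L') \<subseteq> ball b e"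
      using codes_K_small[OF codes_one_zeros \<open>e > 0\<close>] by blast
    obtain \<alpha> i where s: "codes (shift i (code \<alpha>)) x" using xS by (rule SE)
    \<comment> \<open>\<open>L'\<close> digits bring the orbit near \<open>b\<close>;
      \<open>m + L\<close> digits leave \<open>L\<close> zeros after \<open>m\<close> steps, enough
      to be near \<open>z\<close>.\<close>
    obtain n where n: "n \<ge> N" "(f ^^ n) x \<in> K (pre (\<lambda>i. i = 0) (max L' (m + L)))"
        "(f ^^ (n + m)) x \<in> K (pre (\<lambda>_. False) L)"
    proof -
      obtain n where n: "n \<ge> N + i" "code \<alpha> n"
        "\<And>\<alpha> r. 0 < r \<Longrightarrow> r \<le> max L' (m + L) \<Longrightarrow> \<not> code \<alpha> (n + r)"
        using code_isolated_one by metis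
      have idx: "i + (n - i + r) = n + r" for r using n(1) by simp
      have digit: "code \<alpha> (n + r) \<longleftrightarrow> r = 0" if "r < max L' (m + L)" for r
        using n(2) n(3)[of r \<alpha>] that by (cases "r = 0") auto
      have "pre (shift (n - i) (shift i (code \<alpha>))) (max L' (m + L)) = pre (\<lambda>i. i = 0) (max L' (m + L))"
        unfolding pre_def map_eq_conv by (simp add: idx digit)
      moreover have "pre (shift (n - i + m) (shift i (code \<alpha>))) L = pre (\<lambda>_. False) L"
        unfolding pre_def map_eq_conv using m(1) by (simp add: idx digit add.assoc)
      ultimately have "(f ^^ (n - i)) x \<in> K (pre (\<lambda>i. i = 0) (max L' (m + L)))"
          "(f ^^ (n - i + m)) x \<in> K (pre (\<lambda>_. False) L)"
        using codes_K[OF codes_funpow[OF s, of "n - i"], of "max L' (m + L)"]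
          codes_K[OF codes_funpow[OF s, of "n - i + m"], of L] by simp_all
      then show ?thesis using that[of "n - i"] n(1) by simp
    qed
    have "(f ^^ n) x \<in> ball b e"
      by (rule subsetD[OF L' subsetD[OF K_pre_mono[OF max.cobounded1] n(2)]])
    then have 1: "b - (f ^^ n) x < e"
      by (simp add: dist_real_def)
    have "(f ^^ (n + m)) x \<in> ball z e" by (rule subsetD[OF L n(3)])
    then have 2: "(f ^^ (n + m)) x - z < e"
      by (simp add: dist_real_def)
    have 3: "(f ^^ (n + m)) p = (f ^^ n) p"
      unfolding funpow_add comp_apply m(2) ..
    \<comment> \<open>Here \<open>u\<close> stands for the common position of the orbit of
      \<open>p\<close> at both times; by the triangle inequality it cannot be close to both
      \<open>r\<close> near \<open>b\<close> and \<open>t\<close> near \<open>z\<close>.\<close>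
    have far: "\<bar>r - u\<bar> > (b - z) / 2 - e \<or> \<bar>t - u\<bar> > (b - z) / 2 - e"
      if "b - r < e" "t - z < e" for r t u
    proof (rule ccontr)
      assume "\<not> ?thesis"
      then have "\<bar>r - u\<bar> \<le> (b - z) / 2 - e" "\<bar>t - u\<bar> \<le> (b - z) / 2 - e"
        by (simp_all only: de_Morgan_disj not_less)
      then have "r - u \<le> (b - z) / 2 - e" "u - t \<le> (b - z) / 2 - e"
        by (simp_all only: abs_le_iff minus_diff_eq)
      then have "r - t \<le> (b - z) - 2 * e"
        by (simp add: field_simps)
      then show False using that by simp
    qed
    have "\<bar>(f ^^ n) x - (f ^^ n) p\<bar> > (b - z) / 2 - e \<or>
        \<bar>(f ^^ (n + m)) x - (f ^^ (n + m)) p\<bar> > (b - z) / 2 - e"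
      unfolding 3 using 1 2 by (rule far)
    then show "\<exists>n\<ge>N. \<bar>(f ^^ n) x - (f ^^ n) p\<bar> > (b - z) / 2 - e"
      using n(1) trans_le_add1 by blast
  qed
  ultimately show ?thesis
    unfolding scrambled_set_def zb
    using uncountable_S S_subset segment_subset z_less_c c_less_b by auto
qed

section \<open>Periodic points in the omega-limit sets\<close>

text \<open>The period is only determined up to a factor 2: the limits of the even and of the odd iterates of
  the decreasing map \<open>E\<close> are exchanged by \<open>f ^^ n\<close> and may differ.\<close>

lemma approximable_periodic:
  assumes "n > 0"
  obtains u where "approximable u" "has_least_period I f n u \<or> has_least_period I f (2 * n) u"
proof -
  define w where "w = True # replicate (n - 1) False"
  define W where "W k = concat (replicate k w)" for k
  define E where "E = \<Phi> w"
  define e where "e k = (E ^^ k) z" for k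
  have len_w: "length w = n" using assms by (simp add: w_def)
  have len_W: "length (W k) = k * n" for k by (simp add: W_def length_concat sum_list_replicate len_w)
  have \<Phi>_W: "\<Phi> (W k) = E ^^ k" for k by (induction k) (simp_all add: W_def E_def)
  have W_nth: "W k ! i = (i mod n = 0)" if "i < k * n" for i k
    using that
  proof (induction k arbitrary: i)
    case (Suc k)
    have W: "W (Suc k) = w @ W k" by (simp add: W_def)
    show ?case
    proof (cases "i < n")
      case True
      then show ?thesis by (cases i) (auto simp: W nth_append len_w w_def)
    next
      case False
      then have "W (Suc k) ! i = W k ! (i - n)" by (simp add: W nth_append len_w)
      also have "\<dots> = ((i - n) mod n = 0)" using Suc False by simp
      also have "(i - n) mod n = i mod n" using False by (simp add: le_mod_geq)
      finally show ?thesis .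
    qed
  qed simp
  have E_mem: "E y \<in> {z..b}" if "y \<in> {z..b}" for y
    using \<Phi>_mem that by (simp add: E_def)
  have e_mem: "e k \<in> {z..b}" for k
    using \<Phi>_mem[OF z_mem, of "W k"] by (simp add: e_def \<Phi>_W)
  have e_Suc: "e (Suc k) = E (e k)" for k by (simp add: e_def)
  \<comment> \<open>\<open>w\<close> contains exactly one \<open>True\<close>, so \<open>E\<close>
    reverses the order once.\<close>
  have anti: "E y' < E y" if "y \<in> {z..b}" "y' \<in> {z..b}" "y < y'" for y y'
  proof -
    have "\<Phi> (replicate k False) y < \<Phi> (replicate k False) y'" for k
      using that \<Phi>_mem by (induction k) (auto intro!: \<phi>_False_mono simp del: atLeastAtMost_iff)
    then show ?thesis
      using that \<Phi>_mem by (auto intro!: \<phi>_True_antimono simp: E_def w_def simp del: atLeastAtMost_iff)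
  qed
  have mono2: "(E ^^ (2 * k)) y \<le> (E ^^ (2 * k)) y'" if "y \<in> {z..b}" "y' \<in> {z..b}" "y \<le> y'" for y y' k
  proof (induction k)
    case (Suc k)
    let ?p = "(E ^^ (2 * k)) y" and ?q = "(E ^^ (2 * k)) y'"
    have "?p \<in> {z..b}" "?q \<in> {z..b}" using \<Phi>_mem that \<Phi>_W by metis+
    then have "E (E ?p) \<le> E (E ?q)"
      using Suc anti E_mem by (metis order_le_less)
    then show ?case by simp
  qed (use that in simp)
  have "E z = b"
  proof -
    have "\<Phi> (replicate k False) z = z" for k
      by (induction k) (simp_all add: \<phi>_False_z)
    then show ?thesis by (simp add: E_def w_def \<phi>_True_z)
  qed
  then have e2: "e 2 = E b" by (simp add: e_def numeral_2_eq_2)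
  \<comment> \<open>This puts all values of \<open>\<phi> False\<close> between \<open>z\<close> and
    \<open>e 2\<close>, which is used at the end to approximate \<open>u\<close> by
    cylinders.\<close>
  have "c \<le> e 2"
    unfolding e2 E_def w_def using \<phi>_True(1) \<Phi>_mem[OF b_mem] by (auto simp del: atLeastAtMost_iff) auto
  have e_eq: "e (2 * k + 2) = (E ^^ (2 * k)) (e 2)" for k
    by (simp only: e_def funpow_add comp_apply)
  have "e (2 * k) \<le> e (2 * Suc k)" for k
    using mono2[OF z_mem e_mem[of 2], of k] e_mem[of 2] e_eq[of k] by (simp add: e_def)
  then have "incseq (\<lambda>k. e (2 * k))" by (rule incseq_SucI)
  then obtain u where u: "(\<lambda>k. e (2 * k)) \<longlonglongrightarrow> u" "\<And>k. e (2 * k) \<le> u"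
    using incseq_convergent[of "\<lambda>k. e (2 * k)" b] e_mem by auto
  have fe: "(f ^^ n) (e (Suc k)) = e k" for k
    using f_pow_\<Phi>[OF e_mem[of k], of n w] by (simp add: e_Suc E_def len_w)
  have u_mem: "u \<in> {z..b}"
    using closed_sequentially[of "{z..b}" "\<lambda>k. e (2 * k)" u] u e_mem by auto
  have lim_f: "(\<lambda>k. (f ^^ i) (g k)) \<longlonglongrightarrow> (f ^^ i) y"
    if "\<And>k. g k \<in> I" "g \<longlonglongrightarrow> y" "y \<in> I" for i g y
    using that continuous_on_funpow[OF continuous self_map, of i]
    by (intro continuous_on_tendsto_compose[of I "f ^^ i" g y sequentially]) auto
  have eI: "e k \<in> I" and uI: "u \<in> I" for k using e_mem u_mem segment_subset by blast+
  have fnI: "(f ^^ i) u \<in> I" for i using continuous_on_funpow[OF continuous self_map, of i] uI by blast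
  \<comment> \<open>\<open>E\<close> may be discontinuous, so the limit is passed through
    \<open>f ^^ n\<close>, which undoes \<open>E\<close>: it takes the even iterates to the odd ones
    and these back to the even ones.\<close>
  have "(\<lambda>k. (f ^^ n) (e (2 * Suc k))) \<longlonglongrightarrow> (f ^^ n) u"
    using eI uI LIMSEQ_Suc[OF u(1)] by (intro lim_f)
  then have "(\<lambda>k. e (Suc (2 * k))) \<longlonglongrightarrow> (f ^^ n) u" by (simp add: fe)
  then have "(\<lambda>k. (f ^^ n) (e (Suc (2 * k)))) \<longlonglongrightarrow> (f ^^ n) ((f ^^ n) u)"
    using eI fnI by (intro lim_f)
  then have "(\<lambda>k. e (2 * k)) \<longlonglongrightarrow> (f ^^ n) ((f ^^ n) u)" by (simp add: fe)
  then have "(f ^^ n) ((f ^^ n) u) = u" using u(1) LIMSEQ_unique by blast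
  then have per: "(f ^^ (2 * n)) u = u" by (simp add: mult_2 funpow_add)
  have itin: "(f ^^ i) u \<in> (if i mod n = 0 then {c..b} else {z..c})" for i
  proof (rule Lim_in_closed_set[OF _ _ _ lim_f[OF eI u(1) uI]])
    \<comment> \<open>The point \<open>e (2 * k)\<close> follows the periodic code for
      \<open>2 * k * n\<close> steps, so for fixed \<open>i\<close> the itinerary passes to the
      limit \<open>u\<close>.\<close>
    have "(f ^^ i) (e (2 * k)) \<in> (if i mod n = 0 then {c..b} else {z..c})" if "i < k" for k
    proof -
      have i: "i < 2 * k * n" using that assms by (simp add: less_le_trans mult.assoc trans_less_add1)
      have "(f ^^ i) (e (2 * k)) = \<Phi> (drop i (W (2 * k))) z"
        using f_pow_\<Phi>[OF z_mem, of i "W (2 * k)"] i by (simp add: \<Phi>_W e_def len_W)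
      also have "drop i (W (2 * k)) = W (2 * k) ! i # drop (Suc i) (W (2 * k))"
        using i by (simp add: Cons_nth_drop_Suc len_W)
      finally show ?thesis
        using \<Phi>_K[OF z_mem] K_Cons W_nth[OF i] by (smt (verit) subsetD)
    qed
    then show "\<forall>\<^sub>F k in sequentially. (f ^^ i) (e (2 * k)) \<in> (if i mod n = 0 then {c..b} else {z..c})"
      using eventually_gt_at_top[of i] by (rule eventually_mono[rotated])
  qed auto
  \<comment> \<open>From \<open>c\<close> the orbit reaches the fixed point \<open>z\<close> in two
    steps, but it has to be in \<open>{c..b}\<close> at every multiple of \<open>n\<close>.\<close>
  have not_c: "(f ^^ i) u \<noteq> c" for i
  proof
    assume "(f ^^ i) u = c"
    then have "(f ^^ (i + 2)) u = z" using f_c f_b by simp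
    moreover have "i + 2 \<le> n * (i + 2)" using assms by (cases n) auto
    then have "(f ^^ (n * (i + 2))) u = (f ^^ (n * (i + 2) - (i + 2))) ((f ^^ (i + 2)) u)"
      by (metis comp_apply funpow_add le_add_diff_inverse2)
    ultimately have "(f ^^ (n * (i + 2))) u = z"
      using funpow_fixed f_z by metis
    then show False using itin[of "n * (i + 2)"] z_less_c by simp
  qed
  define d where "d = (LEAST d. 0 < d \<and> (f ^^ d) u = u)"
  have d: "0 < d" "(f ^^ d) u = u"
    using LeastI[of "\<lambda>d. 0 < d \<and> (f ^^ d) u = u" "2 * n"] per assms by (auto simp: d_def)
  have "(f ^^ i) u \<noteq> u" if "0 < i" "i < d" for i
    using that not_less_Least[of i "\<lambda>d. 0 < d \<and> (f ^^ d) u = u"] by (auto simp: d_def)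
  then have lp: "has_least_period I f d u" using d uI by (auto simp: has_least_period_def)
  have "d \<le> 2 * n"
    using Least_le[of "\<lambda>d. 0 < d \<and> (f ^^ d) u = u" "2 * n"] per assms by (auto simp: d_def)
  \<comment> \<open>Otherwise the itinerary puts \<open>u\<close> in \<open>{z..c}\<close> at time
    \<open>d\<close> and in \<open>{c..b}\<close> at time 0, forcing \<open>u = c\<close>.\<close>
  have "n dvd d"
  proof (rule ccontr)
    assume "\<not> n dvd d"
    then have "u \<in> {z..c}" using itin[of d] d by (simp add: dvd_eq_mod_eq_0)
    then show False using itin[of 0] not_c[of 0] by auto
  qed
  then obtain q where "d = n * q" by blast
  then have "q = 1 \<or> q = 2" using \<open>d \<le> 2 * n\<close> d(1) assms by (cases q) auto
  then have "has_least_period I f n u \<or> has_least_period I f (2 * n) u"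
    using lp \<open>d = n * q\<close> by (auto simp: mult.commute)
  moreover have "approximable u"
    unfolding approximable_def
  proof (intro allI impI)
    fix r :: real assume "r > 0"
    then have "\<forall>\<^sub>F k in sequentially. e (2 * k) > u - r" using u(1) by (intro order_tendstoD) auto
    then obtain k where k: "e (2 * k) > u - r" by (auto simp: eventually_sequentially)
    \<comment> \<open>Apply the monotone map \<open>E ^^ (2 * k)\<close> to
      \<open>z \<le> \<phi> False y \<le> e 2\<close>: this cylinder is squeezed between consecutive
      terms of the sequence increasing to \<open>u\<close>.\<close>
    have "\<Phi> (W (2 * k) @ [False]) y \<in> {e (2 * k)..e (2 * k + 2)}" if "y \<in> {z..b}" for y
    proof -
      have "\<phi> False y \<in> {z..c}" using \<phi>_False(1) that by blast
      then have "\<phi> False y \<in> {z..b}" "z \<le> \<phi> False y" "\<phi> False y \<le> e 2"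
        using \<open>c \<le> e 2\<close> c_less_b by auto
      then show ?thesis
        using mono2[of z "\<phi> False y" k] mono2[of "\<phi> False y" "e 2" k] z_mem e_mem[of 2] e_eq[of k]
        by (auto simp: \<Phi>_W e_def)
    qed
    then have "K (W (2 * k) @ [False]) \<subseteq> {e (2 * k)..e (2 * k + 2)}"
      unfolding K_def using z_mem b_mem by (intro closed_segment_subset) auto
    also have "\<dots> \<subseteq> ball u r"
      using k u(2)[of "Suc k"] \<open>r > 0\<close> by (auto simp: dist_real_def)
    finally show "\<exists>w. K w \<subseteq> ball u r" by blast
  qed
  ultimately show ?thesis using that by blast
qed

end

subsection \<open>From turbulence to a horseshoe\<close>

text \<open>Let \<open>l\<close> and \<open>e\<close> be points of the left interval mapped to the
  two ends of the hull. If \<open>l < e\<close>, a fixed point \<open>z\<close> lies between them,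
  \<open>b\<close> is a preimage of \<open>z\<close> in the right interval, and \<open>c\<close>
  lies between \<open>z\<close> and \<open>e\<close>. If \<open>e < l\<close>, \<open>z\<close> is
  taken in the right interval, \<open>b\<close> between \<open>e\<close> and \<open>l\<close>, and
  \<open>c\<close> between \<open>l\<close> and \<open>z\<close>, which gives the reversed
  order.\<close>

lemma turbulent_three_points:
  assumes "is_interval I" "continuous_on I f" "turbulent I f"
  obtains z c b where "f z = z" "f b = z" "f c = b" "z < c \<and> c < b \<or> b < c \<and> c < z"
    "{z, c, b} \<subseteq> I"
proof -
  have main: "\<exists>z c b. f z = z \<and> f b = z \<and> f c = b \<and> (z < c \<and> c < b \<or> b < c \<and> c < z) \<and> {z, c, b} \<subseteq> I"
    if ab: "a0 < b0" "b0 \<le> a1" "a1 < b1" "{a0..b1} \<subseteq> I"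
      and 0: "{a0, b1} \<subseteq> f ` {a0..b0}" and 1: "{a0, b1} \<subseteq> f ` {a1..b1}" for a0 b0 a1 b1
  proof -
    have ivt: "\<exists>x\<in>closed_segment p q. f x = y"
      if "p \<in> {a0..b1}" "q \<in> {a0..b1}" "y \<in> closed_segment (f p) (f q)" for p q y
    proof -
      have sub: "closed_segment p q \<subseteq> {a0..b1}"
        using that by (auto simp: closed_segment_eq_real_ivl)
      have "connected (f ` closed_segment p q)"
        using assms(2) sub ab(4) by (intro connected_continuous_image) (auto intro: continuous_on_subset)
      then have "closed_segment (f p) (f q) \<subseteq> f ` closed_segment p q"
        by (intro closed_segment_subset) (auto simp: is_interval_connected_1 is_interval_convex_1[symmetric])
      then show ?thesis using that by auto
    qed
    obtain l where l: "l \<in> {a0..b0}" "f l = a0" using 0 by force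
    obtain e where e: "e \<in> {a0..b0}" "f e = b1" using 0 by force
    obtain l1 where l1: "l1 \<in> {a1..b1}" "f l1 = a0" using 1 by force
    obtain e1 where e1: "e1 \<in> {a1..b1}" "f e1 = b1" using 1 by force
    \<comment> \<open>\<open>f p\<close> is the left end of the hull and \<open>f q\<close> the
      right end, so \<open>f x - x\<close> changes sign between \<open>p\<close> and
      \<open>q\<close>.\<close>
    have fixed: "\<exists>x\<in>closed_segment p q. f x = x"
      if "p \<in> {a0..b1}" "q \<in> {a0..b1}" "f p = a0" "f q = b1" for p q
    proof -
      have sub: "closed_segment p q \<subseteq> {a0..b1}"
        using that by (auto simp: closed_segment_eq_real_ivl)
      have "connected ((\<lambda>x. f x - x) ` closed_segment p q)"
        using assms(2) sub ab(4) by (intro connected_continuous_image continuous_intros) (auto intro: continuous_on_subset)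
      then have "closed_segment (f p - p) (f q - q) \<subseteq> (\<lambda>x. f x - x) ` closed_segment p q"
        by (intro closed_segment_subset) (auto simp: is_interval_connected_1 is_interval_convex_1[symmetric])
      moreover have "0 \<in> closed_segment (f p - p) (f q - q)"
        using that by (auto simp: closed_segment_eq_real_ivl)
      ultimately have "0 \<in> (\<lambda>x. f x - x) ` closed_segment p q" by blast
      then show ?thesis by auto
    qed
    have "l \<noteq> e" using l e ab by auto
    have mem: "l \<in> {a0..b1}" "e \<in> {a0..b1}" "l1 \<in> {a0..b1}" "e1 \<in> {a0..b1}"
      using l e l1 e1 ab by auto
    have sub1: "closed_segment l1 e1 \<subseteq> {a1..b1}"
      using l1 e1 by (auto simp: closed_segment_eq_real_ivl)
    have seg: "closed_segment a0 b1 = {a0..b1}"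
      using ab by (simp add: closed_segment_eq_real_ivl)
    show ?thesis
    proof (cases "l < e")
      case True
      obtain z where z: "z \<in> {l..e}" "f z = z"
        using fixed[of l e] l e ab True by (auto simp: closed_segment_eq_real_ivl)
      have "z < e" using z e ab by (cases "z = e") auto
      obtain b where b: "b \<in> {a1..b1}" "f b = z"
        using ivt[of l1 e1 z] mem sub1 z(1) seg l1 e1 by (auto simp del: atLeastAtMost_iff) auto
      obtain c where c: "c \<in> {z..e}" "f c = b"
        using ivt[of z e b] z b l e ab \<open>z < e\<close> by (auto simp: closed_segment_eq_real_ivl split: if_splits)
      have "c \<noteq> z" "c \<noteq> b" using z b c e l ab \<open>z < e\<close> by auto
      then have "z < c" "c < b" using c b e ab by auto
      moreover have "{z, c, b} \<subseteq> I" using z b c l e ab by auto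
      ultimately show ?thesis using z b c by blast
    next
      case False
      then have "e < l" using \<open>l \<noteq> e\<close> by simp
      obtain z where z: "z \<in> {a1..b1}" "f z = z"
        using fixed[of l1 e1] mem sub1 l1 e1 by blast
      obtain b where b: "b \<in> {e..l}" "f b = z"
        using ivt[of e l z] l e z ab \<open>e < l\<close> by (auto simp: closed_segment_eq_real_ivl split: if_splits)
      have "b < l" using b z l ab by (cases "b = l") auto
      obtain c where c: "c \<in> {l..z}" "f c = b"
        using ivt[of l z b] z b l e ab by (auto simp: closed_segment_eq_real_ivl split: if_splits)
      have "c \<noteq> z" using z b c l ab \<open>b < l\<close> by auto
      then have "c < z" "b < c" using c \<open>b < l\<close> by auto
      moreover have "{z, c, b} \<subseteq> I" using z b c l e ab by auto
      ultimately show ?thesis using z b c by blast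
    qed
  qed
  obtain a0 b0 a1 b1 p where t: "a0 < b0" "a1 < b1" "{a0..b0} \<subseteq> I" "{a1..b1} \<subseteq> I"
    "{a0..b0} \<inter> {a1..b1} \<subseteq> {p}"
    and im: "{a0..b0} \<union> {a1..b1} \<subseteq> f ` {a0..b0} \<inter> f ` {a1..b1}"
    using assms(3) unfolding turbulent_def by blast
  have hull: "{x..y} \<subseteq> I" if "x \<in> I" "y \<in> I" for x y
    using mem_is_interval_1_I[OF assms(1) that] by auto
  have "b0 \<le> a1 \<or> b1 \<le> a0"
  proof (rule ccontr)
    assume "\<not> ?thesis"
    then have lt: "max a0 a1 < min b0 b1" using t by auto
    have "max a0 a1 \<in> {a0..b0} \<inter> {a1..b1}" "min b0 b1 \<in> {a0..b0} \<inter> {a1..b1}"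
      using lt t by auto
    then show False using t(5) lt by (metis order_less_irrefl singletonD subsetD)
  qed
  then have "\<exists>z c b. f z = z \<and> f b = z \<and> f c = b \<and> (z < c \<and> c < b \<or> b < c \<and> c < z) \<and> {z, c, b} \<subseteq> I"
  proof
    assume "b0 \<le> a1"
    moreover have "{a0, b1} \<subseteq> {a0..b0} \<union> {a1..b1}" using t(1,2) by simp
    moreover have "a0 \<in> I" "b1 \<in> I" using t(1-4) by auto
    ultimately show ?thesis
      using main[of a0 b0 a1 b1] t(1,2) im hull[of a0 b1] by blast
  next
    assume "b1 \<le> a0"
    moreover have "{a1, b0} \<subseteq> {a0..b0} \<union> {a1..b1}" using t(1,2) by simp
    moreover have "a1 \<in> I" "b0 \<in> I" using t(1-4) by auto
    ultimately show ?thesis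
      using main[of a1 b1 a0 b0] t(1,2) im hull[of a1 b0] by blast
  qed
  then show ?thesis using that by blast
qed

text \<open>The order of choices matters: \<open>z'\<close> is the last fixed point in
  \<open>{z..c}\<close>, \<open>b'\<close> the first preimage of this \<open>z'\<close> in
  \<open>{c..b}\<close>, and \<open>c'\<close> a preimage of \<open>b'\<close> in
  \<open>{z'..c}\<close>.\<close>

lemma horseshoe_exists:
  assumes "is_interval I" "continuous_on I f" "f ` I \<subseteq> I"
    and zcb: "f z = z" "f b = z" "f c = b" "z < c" "c < b" "{z, c, b} \<subseteq> I"
  obtains z' c' b' where "horseshoe I f z' c' b'"
proof -
  have sub: "{z..b} \<subseteq> I" using mem_is_interval_1_I[OF assms(1), of z b] zcb by auto
  have cont: "continuous_on {p..q} f" if "z \<le> p" "q \<le> b" for p q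
    by (rule continuous_on_subset[OF assms(2)]) (use that sub in auto)
  define A where "A = {x \<in> {z..c}. f x - x = 0}"
  have "continuous_on {z..c} (\<lambda>x. f x - x)"
    using cont[of z c] zcb by (intro continuous_intros) auto
  then have "closed A"
    unfolding A_def using continuous_closed_preimage_constant by blast
  have A: "z \<in> A" "bdd_above A"
    unfolding A_def using zcb(1,4,5) by (auto intro!: bdd_aboveI[of _ c])
  have z': "Sup A \<in> A"
    by (rule closed_contains_Sup[OF _ A(2) \<open>closed A\<close>]) (use A(1) in auto)
  define z' where "z' = Sup A"
  have z'_fixed: "f z' = z'" and z_le: "z \<le> z'" and "z' \<le> c"
    using z'[folded z'_def] by (simp_all add: A_def)
  have "z' \<noteq> c"
  proof
    assume "z' = c"
    then have "c = b" using z'_fixed zcb(3) by simp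
    then show False using zcb(5) by simp
  qed
  with \<open>z' \<le> c\<close> have "z' < c" by simp
  have z'_max: "f x \<noteq> x" if "z' < x" "x \<le> c" for x
  proof
    assume "f x = x"
    then have "x \<in> A" using that z_le by (simp add: A_def)
    then show False using cSup_upper[OF _ A(2), of x] that(1) by (simp add: z'_def)
  qed
  \<comment> \<open>Since \<open>f c = b > c\<close> and no fixed point is left on the way to
    \<open>c\<close>, the graph stays above the diagonal.\<close>
  have above: "f x > x" if x: "z' < x" "x \<le> c" for x
  proof (rule ccontr)
    assume "\<not> f x > x"
    moreover have "continuous_on {x..c} (\<lambda>x. f x - x)"
      using cont[of x c] x z_le zcb(5) by (intro continuous_intros) simp
    ultimately obtain y where "x \<le> y" "y \<le> c" "f y - y = 0"
      using IVT'[of "\<lambda>x. f x - x" x 0 c] x zcb(3,5) by force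
    then show False using z'_max[of y] x by simp
  qed
  define B where "B = {x \<in> {c..b}. f x = z'}"
  have cont_cb: "continuous_on {c..b} f"
    by (rule cont) (use zcb(4) in simp_all)
  then have "closed B"
    unfolding B_def using continuous_closed_preimage_constant by blast
  obtain x where "c \<le> x" "x \<le> b" "f x = z'"
    using IVT2'[of f b z' c, OF _ _ _ cont_cb] zcb(2,3,5) z_le \<open>z' < c\<close> by force
  then have "x \<in> B" by (simp add: B_def)
  have bdd: "bdd_below B" by (rule bdd_belowI[of _ c]) (simp add: B_def)
  have b': "Inf B \<in> B"
    by (rule closed_contains_Inf[OF _ bdd \<open>closed B\<close>]) (use \<open>x \<in> B\<close> in auto)
  define b' where "b' = Inf B"
  have f_b': "f b' = z'" and "c \<le> b'" and b'_le: "b' \<le> b"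
    using b'[folded b'_def] by (simp_all add: B_def)
  have "c \<noteq> b'"
  proof
    assume "c = b'"
    then have "b = z'" using f_b' zcb(3) by simp
    then show False using zcb(5) \<open>z' < c\<close> by simp
  qed
  with \<open>c \<le> b'\<close> have "c < b'" by simp
  have b'_min: "f x \<noteq> z'" if "c \<le> x" "x < b'" for x
  proof
    assume "f x = z'"
    then have "x \<in> B" using that b'_le by (simp add: B_def)
    then show False using cInf_lower[OF _ bdd, of x] that(2) by (simp add: b'_def)
  qed
  have "continuous_on {z'..c} f"
    by (rule cont) (use zcb(5) z_le in simp_all)
  then obtain c' where c': "z' \<le> c'" "c' \<le> c" "f c' = b'"
    using IVT'[of f z' b' c] zcb(3) z'_fixed \<open>z' < c\<close> \<open>c < b'\<close> b'_le by force
  have "z' \<noteq> c'"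
  proof
    assume "z' = c'"
    then have "z' = b'" using z'_fixed c'(3) by simp
    then show False using \<open>z' < c\<close> \<open>c < b'\<close> by simp
  qed
  with c'(1) have "z' < c'" by simp
  have "horseshoe I f z' c' b'"
  proof
    show "{z'..b'} \<subseteq> I"
      using sub z_le b'_le by (meson atLeastatMost_subset_iff order_trans)
    \<comment> \<open>\<open>c'\<close> may lie to the left of \<open>c\<close>, where minimality of
      \<open>b'\<close> says nothing; there \<open>f x > x > z'\<close>.\<close>
    show "f x \<noteq> z'" if "c' \<le> x" "x < b'" for x
    proof (cases "x \<le> c")
      case True
      then show ?thesis using above[of x] that(1) \<open>z' < c'\<close> by simp
    next
      case False
      then show ?thesis using b'_min[of x] that(2) by simp
    qed
    show "c' < b'" using c'(2) \<open>c < b'\<close> by simp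
    show "f x \<noteq> x" if "z' < x" "x \<le> c'" for x
      using z'_max[of x] that c'(2) by simp
  qed (fact assms(2,3) z'_fixed f_b' c'(3) \<open>z' < c'\<close>)+
  then show ?thesis by (rule that)
qed

text \<open>The conclusion of the theorem for given \<open>z\<close>, \<open>b\<close>,
  \<open>S\<close>, bundled so that it can be carried over by reflection.\<close>

definition rich_scrambled :: "real set \<Rightarrow> (real \<Rightarrow> real) \<Rightarrow> real \<Rightarrow> real \<Rightarrow> real set \<Rightarrow> bool" where
  "rich_scrambled I f z b S \<longleftrightarrow>
    z \<in> I \<and> f z = z \<and> b \<in> I \<and> b \<noteq> z \<and> f b = z \<and>
    uncountable S \<and> invariant_set f S \<and> scrambled_set I f \<bar>b - z\<bar> S \<and>
    S \<subseteq> closed_segment z b \<and> S \<subseteq> recurrent_set I f \<and>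
    {z, b} \<union> S \<subseteq> (\<Inter>x\<in>S. omega_limit f x) \<and>
    (\<forall>n>0. \<exists>p \<in> (\<Inter>x\<in>S. omega_limit f x).
       has_least_period I f n p \<or> has_least_period I f (2 * n) p)"

lemma (in horseshoe) rich_scrambled_S: "rich_scrambled I f z b S"
proof -
  have "\<exists>p \<in> (\<Inter>x\<in>S. omega_limit f x). has_least_period I f n p \<or> has_least_period I f (2 * n) p"
    if "n > 0" for n
    using approximable_periodic[OF that] approximable_omega by (metis INT_I)
  then show ?thesis
    unfolding rich_scrambled_def
    using f_z f_b z_less_c c_less_b z_mem b_mem segment_subset uncountable_S scrambled_S S_subset
      S_invariant approximable_omega approximable_z approximable_b S_approximable
    by (auto simp: invariant_set_def recurrent_set_def closed_segment_eq_real_ivl)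
qed

subsection \<open>Reflection\<close>

lemma mem_uminus_image: "x \<in> uminus ` A \<longleftrightarrow> - x \<in> A" for x :: real
  by (metis image_iff minus_minus)

lemma funpow_conj_uminus: "((\<lambda>x. - f (- x)) ^^ n) x = - (f ^^ n) (- x)" for f :: "real \<Rightarrow> real"
  by (induction n) auto

lemma omega_limit_conj_uminus:
  "y \<in> omega_limit (\<lambda>x. - f (- x)) x \<longleftrightarrow> - y \<in> omega_limit f (- x)"
  unfolding omega_limit_def by (auto simp: funpow_conj_uminus tendsto_minus_cancel_left)

lemma has_least_period_conj_uminus:
  "has_least_period (uminus ` I) (\<lambda>x. - f (- x)) n p \<longleftrightarrow> has_least_period I f n (- p)"
  by (auto simp: has_least_period_def funpow_conj_uminus mem_uminus_image minus_equation_iff[of _ p])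

text \<open>Negation is an isometric conjugacy, so it preserves distances between orbits, least
  periods and omega-limit sets.\<close>

lemma rich_scrambled_conj_uminus:
  assumes "rich_scrambled (uminus ` I) (\<lambda>x. - f (- x)) z b S"
  shows "rich_scrambled I f (- z) (- b) (uminus ` S)"
proof -
  let ?g = "\<lambda>x. - f (- x)"
  note inv = mem_uminus_image
  have om: "y \<in> (\<Inter>x\<in>uminus ` S. omega_limit f x) \<longleftrightarrow> - y \<in> (\<Inter>x\<in>S. omega_limit ?g x)" for y
    by (simp add: omega_limit_conj_uminus)
  have per: "periodic_point (uminus ` I) ?g (- p) \<longleftrightarrow> periodic_point I f p" for p
    by (simp add: periodic_point_def has_least_period_conj_uminus)
  have dist: "\<bar>(?g ^^ n) (- x) - (?g ^^ n) (- y)\<bar> = \<bar>(f ^^ n) x - (f ^^ n) y\<bar>" for n x y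
    by (simp add: funpow_conj_uminus abs_minus_commute)
  have a: "scrambled_set (uminus ` I) ?g \<bar>b - z\<bar> S"
    using assms by (simp add: rich_scrambled_def)
  have "scrambled_set I f \<bar>b - z\<bar> (uminus ` S)"
    unfolding scrambled_set_def
  proof (intro conjI ballI impI allI)
    show "0 < \<bar>b - z\<bar>" using a by (simp add: scrambled_set_def)
    show "uminus ` S \<subseteq> I" using a by (auto simp: scrambled_set_def inv)
    show "uncountable (uminus ` S)"
      using a countable_image_inj_on[of uminus S] by (auto simp: scrambled_set_def)
  next
    fix x y assume "x \<in> uminus ` S" "y \<in> uminus ` S" "x \<noteq> y"
    then have "- x \<in> S" "- y \<in> S" "- x \<noteq> - y" by (simp_all add: inv)
    then have "limsup (\<lambda>n. ereal \<bar>(?g ^^ n) (- x) - (?g ^^ n) (- y)\<bar>) \<ge> ereal \<bar>b - z\<bar> \<and>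
        liminf (\<lambda>n. ereal \<bar>(?g ^^ n) (- x) - (?g ^^ n) (- y)\<bar>) = 0"
      using a unfolding scrambled_set_def by blast
    then show "limsup (\<lambda>n. ereal \<bar>(f ^^ n) x - (f ^^ n) y\<bar>) \<ge> ereal \<bar>b - z\<bar>"
      "liminf (\<lambda>n. ereal \<bar>(f ^^ n) x - (f ^^ n) y\<bar>) = 0"
      unfolding dist by auto
  next
    fix x p assume "x \<in> uminus ` S" "periodic_point I f p"
    then have "- x \<in> S" "periodic_point (uminus ` I) ?g (- p)" by (simp_all add: inv per)
    then have "limsup (\<lambda>n. ereal \<bar>(?g ^^ n) (- x) - (?g ^^ n) (- p)\<bar>) \<ge> ereal (\<bar>b - z\<bar> / 2)"
      using a unfolding scrambled_set_def by blast
    then show "limsup (\<lambda>n. ereal \<bar>(f ^^ n) x - (f ^^ n) p\<bar>) \<ge> ereal (\<bar>b - z\<bar> / 2)"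
      unfolding dist .
  qed
  moreover have "\<bar>- b - - z\<bar> = \<bar>b - z\<bar>" by simp
  moreover have "uminus ` S \<subseteq> closed_segment (- z) (- b)"
    using assms by (auto simp: rich_scrambled_def closed_segment_eq_real_ivl split: if_splits)
  moreover have "\<exists>p \<in> (\<Inter>x\<in>uminus ` S. omega_limit f x).
       has_least_period I f n p \<or> has_least_period I f (2 * n) p" if "n > 0" for n
  proof -
    have "\<exists>p \<in> (\<Inter>x\<in>S. omega_limit ?g x).
       has_least_period (uminus ` I) ?g n p \<or> has_least_period (uminus ` I) ?g (2 * n) p"
      using assms that unfolding rich_scrambled_def by blast
    then obtain p where "p \<in> (\<Inter>x\<in>S. omega_limit ?g x)"
      "has_least_period I f n (- p) \<or> has_least_period I f (2 * n) (- p)"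
      unfolding has_least_period_conj_uminus by blast
    then show ?thesis using om[of "- p"] by auto
  qed
  moreover have "{- z, - b} \<union> uminus ` S \<subseteq> (\<Inter>x\<in>uminus ` S. omega_limit f x)"
  proof
    fix y assume "y \<in> {- z, - b} \<union> uminus ` S"
    then have "- y \<in> {z, b} \<union> S" by auto
    then show "y \<in> (\<Inter>x\<in>uminus ` S. omega_limit f x)"
      unfolding om using assms unfolding rich_scrambled_def by blast
  qed
  moreover have "uminus ` S \<subseteq> recurrent_set I f"
    using assms by (auto simp: rich_scrambled_def recurrent_set_def omega_limit_conj_uminus inv)
  moreover have "invariant_set f (uminus ` S)"
    using assms by (auto simp: rich_scrambled_def invariant_set_def inv)
  moreover have "- z \<in> I" "f (- z) = - z" "- b \<in> I" "- b \<noteq> - z" "f (- b) = - z"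
    using assms by (auto simp: rich_scrambled_def inv minus_equation_iff[of _ z])
  ultimately show ?thesis
    unfolding rich_scrambled_def by (simp add: scrambled_set_def)
qed

theorem theorem1:
  fixes I :: "real set" and f :: "real \<Rightarrow> real"
  assumes "is_interval I" and "compact I"
    and "continuous_on I f" and "f ` I \<subseteq> I"
    and "turbulent I f"
  shows "\<exists>z b S.
    z \<in> I \<and> f z = z \<and> b \<in> I \<and> b \<noteq> z \<and> f b = z \<and>
    uncountable S \<and> invariant_set f S \<and> scrambled_set I f \<bar>b - z\<bar> S \<and>
    S \<subseteq> closed_segment z b \<and> S \<subseteq> recurrent_set I f \<and>
    {z, b} \<union> S \<subseteq> (\<Inter>x\<in>S. omega_limit f x) \<and>
    (\<forall>n>0. \<exists>p \<in> (\<Inter>x\<in>S. omega_limit f x).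
       has_least_period I f n p \<or> has_least_period I f (2 * n) p)"
proof -
  obtain z c b where zcb: "f z = z" "f b = z" "f c = b" "z < c \<and> c < b \<or> b < c \<and> c < z" "{z, c, b} \<subseteq> I"
    using turbulent_three_points[OF assms(1,3,5)] .
  have "\<exists>z b S. rich_scrambled I f z b S"
    using zcb(4)
  proof
    assume "z < c \<and> c < b"
    then obtain z' c' b' where "horseshoe I f z' c' b'"
      using horseshoe_exists[OF assms(1,3,4)] zcb by metis
    then show ?thesis using horseshoe.rich_scrambled_S by blast
  next
    assume lt: "b < c \<and> c < z"
    \<comment> \<open>Reflection turns the order \<open>b < c < z\<close> into the one required by
      \<open>horseshoe\<close>.\<close>
    let ?g = "\<lambda>x. - f (- x)" and ?I = "uminus ` I"
    have "continuous_on ?I ?g"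
      by (intro continuous_intros continuous_on_compose2[OF assms(3)]) auto
    moreover have "?g ` ?I \<subseteq> ?I" using assms(4) by auto
    moreover have "is_interval ?I" using assms(1) by simp
    moreover have "?g (- z) = - z" "?g (- b) = - z" "?g (- c) = - b" "- z < - c" "- c < - b"
        "{- z, - c, - b} \<subseteq> ?I"
      using zcb lt by simp_all
    ultimately obtain z' c' b' where "horseshoe ?I ?g z' c' b'"
      using horseshoe_exists[of ?I ?g "- z" "- b" "- c"] by metis
    then show ?thesis
      using horseshoe.rich_scrambled_S rich_scrambled_conj_uminus by blast
  qed
  then show ?thesis unfolding rich_scrambled_def .
qed

end
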